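(* Let $X$ be a Polish space and let $f:X\to 2^\omega$ be a Borel function. Then precisely one of the following conditions holds: (1) either $f$ is $\sigma$-continuous, (2) or there are an open injection $\psi:\omega^\omega\to 2^\omega$ and a continuous injection $\varphi:(\omega+1)^\omega\to X$ such that the square formed by $P:(\omega+1)^\omega\to\omega^\omega$, $\psi$, $\varphi$ and $f$ commutes, i.e. $\psi\circ P=f\circ\varphi$.
   Context: A Borel function $f:X\to Y$ between Polish spaces is called $\sigma$-continuous if there is a countable cover $X=\bigcup_{n} X_n$ (with arbitrary sets $X_n$) such that $f\upharpoonright X_n$ is continuous for each $n$. The space $(\omega+1)^\omega$ carries the product topology of the order topologies on $\omega+1$; $\omega^\omega$ and $2^\omega$ carry the product topologies of discrete spaces. The Pawlikowski function $P:(\omega+1)^\omega\to\omega^\omega$ is defined by $P(x)(n)=x(n)+1$ if $x(n)<\omega$, and $P(x)(n)=0$ if $x(n)=\omega$.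
   Formalization: "Open injection" ψ is taken to mean injective and open onto its range, since with openness into all of 2^ω the dichotomy fails (take f = e∘P with e an embedding of ω^ω into 2^ω with nowhere dense range); X is taken to be nonempty. *)

theory Defs
  imports "HOL-Analysis.Analysis"
begin

text \<open>
  The space \<open>\<omega> + 1\<close> is \<^typ>\<open>enat\<close> with its order topology; \<open>nat\<close> and \<open>bool\<close> are discrete and
  function types carry the product topology. So \<open>(\<omega> + 1)\<^sup>\<omega>\<close>, \<open>\<omega>\<^sup>\<omega>\<close> and \<open>2\<^sup>\<omega>\<close> are the types
  \<open>nat \<Rightarrow> enat\<close>, \<open>nat \<Rightarrow> nat\<close> and \<open>nat \<Rightarrow> bool\<close>.
\<close>

definition sigma_continuous :: "('a::topological_space \<Rightarrow> 'b::topological_space) \<Rightarrow> bool" where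
  "sigma_continuous f \<longleftrightarrow>
     (\<exists>A :: nat \<Rightarrow> 'a set. (\<Union>n. A n) = UNIV \<and> (\<forall>n. continuous_on (A n) f))"

definition pawlikowski :: "(nat \<Rightarrow> enat) \<Rightarrow> (nat \<Rightarrow> nat)" where
  "pawlikowski x n = (case x n of enat k \<Rightarrow> k + 1 | \<infinity> \<Rightarrow> 0)"

text \<open>
  An open injection is open onto its range, as for embeddings, and is not required to be continuous.
  Openness into the whole codomain would make the dichotomy false: if \<open>e\<close> embeds
  \<open>\<omega>\<^sup>\<omega>\<close> in \<open>2\<^sup>\<omega>\<close> with nowhere dense range, then \<open>e \<circ> pawlikowski\<close> is not
  \<open>\<sigma>\<close>-continuous, but \<open>\<psi> \<circ> pawlikowski = (e \<circ> pawlikowski) \<circ> \<phi>\<close> forces the range of \<open>\<psi>\<close>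
  into that of \<open>e\<close>, since \<open>pawlikowski\<close> is onto.
\<close>

definition open_injection :: "('a::topological_space \<Rightarrow> 'b::topological_space) \<Rightarrow> bool" where
  "open_injection g \<longleftrightarrow> inj g \<and> open_map euclidean (top_of_set (range g)) g"

definition contains_pawlikowski :: "('a::topological_space \<Rightarrow> (nat \<Rightarrow> bool)) \<Rightarrow> bool" where
  "contains_pawlikowski f \<longleftrightarrow>
     (\<exists>(\<psi> :: (nat \<Rightarrow> nat) \<Rightarrow> (nat \<Rightarrow> bool)) (\<phi> :: (nat \<Rightarrow> enat) \<Rightarrow> 'a).
        open_injection \<psi> \<and> continuous_on UNIV \<phi> \<and> inj \<phi> \<and> \<psi> \<circ> pawlikowski = f \<circ> \<phi>)"

end

theory Submission
  imports Defs
begin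

text \<open>
  A Borel function \<open>f : X \<rightarrow> 2\<^sup>\<omega>\<close> unfolds: there are a Polish space \<open>Z\<close>, a closed \<open>F \<subseteq> Z\<close> and continuous
  maps \<open>p\<close> from \<open>F\<close> onto \<open>X\<close> and \<open>g : F \<rightarrow> 2\<^sup>\<omega>\<close> with \<open>g = f \<circ> p\<close>. Call \<open>A \<subseteq> F\<close> null if \<open>f\<close> is
  \<open>\<sigma>\<close>-continuous on \<open>p(A)\<close>. If a positive set \<open>V\<close> contained no disjoint pieces \<open>A\<close>, \<open>B\<close>, cut out by
  the value of one bit of \<open>g\<close>, with \<open>B\<close> positive and \<open>A\<close> positive in every neighbourhood in \<open>X\<close> of
  points of \<open>B\<close>, then \<open>f\<close> would be continuous on \<open>V\<close> up to null sets. Starting from this, points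
  \<open>z(x)\<close> of \<open>F\<close>, for \<open>x \<in> (\<omega> + 1)\<^sup>\<omega>\<close>, are found by fusion. At every stage finitely many approximations
  of \<open>x\<close> are considered; each carries a finite chain of reservoirs, one for every coordinate \<open>i\<close> that is
  still \<open>\<infinity>\<close>, from which the points with \<open>x(i) = k\<close> for large \<open>k\<close> are drawn close to the current
  neighbourhood in \<open>X\<close>. The neighbourhoods shrink, which makes \<open>p \<circ> z\<close> continuous, and the values of
  \<open>g\<close> are kept apart, which makes \<open>x(n)\<close> a continuous function of \<open>f(p(z(x)))\<close> with values in a
  discrete set. That is the required open injection.

  Conversely, a copy of the Pawlikowski function in \<open>f\<close> would make that function \<open>\<sigma>\<close>-continuous if
  \<open>f\<close> is. But every finite sequence has a finite extension none of whose continuations lies in a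
  given set of continuity, so a diagonal sequence escapes from countably many such sets.
\<close>

subsection \<open>Unfolding Borel functions\<close>

text \<open>Analytic sets, coded as projections of closed sets along
  \<open>nat \<Rightarrow> real\<close>. Real witness sequences keep the product with a Polish space
  complete and second countable.\<close>

definition souslin :: "'a::metric_space set \<Rightarrow> bool" where
  "souslin B \<longleftrightarrow> (\<exists>F :: ('a \<times> (nat \<Rightarrow> real)) set. closed F \<and> B = fst ` F)"

lemma continuous_on_reindex_snd:
  "continuous_on UNIV (\<lambda>z :: 'a::topological_space \<times> (nat \<Rightarrow> real). (fst z, \<lambda>k. snd z (h k)))"
  by (intro continuous_intros continuous_on_coordinatewise_then_product
        continuous_on_product_then_coordinatewise)

lemma continuous_on_snd_coord:
  "continuous_on UNIV (\<lambda>z :: 'a::topological_space \<times> (nat \<Rightarrow> real). snd z k)"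
  by (intro continuous_intros continuous_on_product_then_coordinatewise)

lemma souslin_closed: "closed B \<Longrightarrow> souslin B"
  unfolding souslin_def by (rule exI[of _ "B \<times> UNIV"]) (auto simp: closed_Times)

lemma souslin_UN:
  assumes "\<And>n::nat. souslin (B n)"
  shows "souslin (\<Union>n. B n)"
proof -
  obtain F :: "nat \<Rightarrow> ('a \<times> (nat \<Rightarrow> real)) set"
    where F: "\<And>n. closed (F n)" "\<And>n. B n = fst ` F n"
    using assms unfolding souslin_def by metis
  define tl where "tl = (\<lambda>z :: 'a \<times> (nat \<Rightarrow> real). (fst z, \<lambda>k. snd z (Suc k)))"
  \<comment> \<open>Coordinate 0 names the member of the union, the shifted sequence is its witness.
    The implication "if coordinate 0 is \<open>n\<close>, then the tail lies in \<open>F n\<close>"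
    stays closed because distinct naturals are at distance at least 1.\<close>
  define G where "G = {z. snd z 0 \<in> \<nat>} \<inter> (\<Inter>n. {z. \<bar>snd z 0 - real n\<bar> \<ge> 1} \<union> tl -` F n)"
  have "closed (\<nat> :: real set)" by (rule closed_Nats)
  then have "closed {z :: 'a \<times> (nat \<Rightarrow> real). snd z 0 \<in> \<nat>}"
    using closed_vimage[OF _ continuous_on_snd_coord[of 0], of \<nat>] by (simp add: vimage_def)
  moreover have "closed {z :: 'a \<times> (nat \<Rightarrow> real). \<bar>snd z 0 - real n\<bar> \<ge> 1}" for n
    by (intro closed_Collect_le continuous_intros continuous_on_snd_coord)
  moreover have "closed (tl -` F n)" for n
    unfolding tl_def by (rule closed_vimage[OF F(1) continuous_on_reindex_snd])
  ultimately have "closed G" unfolding G_def by (intro closed_Int closed_INT closed_Un ballI)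
  moreover have "(\<Union>n. B n) = fst ` G"
  proof (intro set_eqI iffI)
    fix x assume "x \<in> (\<Union>n. B n)"
    then obtain n w where w: "(x, w) \<in> F n" using F(2) by auto
    have "\<bar>real n - real m\<bar> \<ge> 1" if "n \<noteq> m" for m
      using that by (cases "n < m") auto
    then have "(x, case_nat (real n) w) \<in> G"
      using w by (auto simp: G_def tl_def) metis
    then show "x \<in> fst ` G" by force
  next
    fix x assume "x \<in> fst ` G"
    then obtain w where w: "(x, w) \<in> G" by auto
    then obtain n where n: "w 0 = real n" by (auto simp: G_def elim: Nats_cases)
    have "(x, w) \<in> {z. \<bar>snd z 0 - real n\<bar> \<ge> 1} \<union> tl -` F n" using w by (auto simp: G_def)
    then have "tl (x, w) \<in> F n" using n by auto
    then show "x \<in> (\<Union>n. B n)" using F(2) by (force simp: tl_def)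
  qed
  ultimately show ?thesis unfolding souslin_def by blast
qed

text \<open>One sequence interleaves, through \<open>prod_encode\<close>, a witness for each of the
  sets.\<close>

lemma souslin_INT:
  assumes "\<And>n::nat. souslin (B n)"
  shows "souslin (\<Inter>n. B n)"
proof -
  obtain F :: "nat \<Rightarrow> ('a \<times> (nat \<Rightarrow> real)) set"
    where F: "\<And>n. closed (F n)" "\<And>n. B n = fst ` F n"
    using assms unfolding souslin_def by metis
  define G where "G = (\<Inter>n. (\<lambda>z. (fst z, \<lambda>k. snd z (prod_encode (n, k)))) -` F n)"
  have "closed G" unfolding G_def
    by (intro closed_INT ballI closed_vimage[OF F(1) continuous_on_reindex_snd])
  moreover have "(\<Inter>n. B n) = fst ` G"
  proof (intro set_eqI iffI)
    fix x assume "x \<in> (\<Inter>n. B n)"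
    then have "\<forall>n. \<exists>w. (x, w) \<in> F n" using F(2) by force
    then obtain w where w: "\<And>n. (x, w n) \<in> F n" by metis
    have "(x, \<lambda>j. case prod_decode j of (n, k) \<Rightarrow> w n k) \<in> G" using w by (auto simp: G_def)
    then show "x \<in> fst ` G" by force
  next
    fix x assume "x \<in> fst ` G"
    then show "x \<in> (\<Inter>n. B n)" using F(2) by (force simp: G_def)
  qed
  ultimately show ?thesis unfolding souslin_def by blast
qed

text \<open>An open set is the countable union of the closed sets of points at distance at least
  \<open>1 / Suc n\<close> from its complement. The whole space is treated apart, since
  \<open>infdist\<close> to the empty set is 0.\<close>

lemma souslin_open:
  assumes "open (B :: 'a::metric_space set)"
  shows "souslin B"
proof (cases "B = UNIV")
  case True
  then show ?thesis by (simp add: souslin_closed)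
next
  case False
  have "(\<Union>n. {x. infdist x (- B) \<ge> 1 / real (Suc n)}) = B"
  proof (intro set_eqI iffI)
    fix x assume "x \<in> (\<Union>n. {x. infdist x (- B) \<ge> 1 / real (Suc n)})"
    then obtain n where "infdist x (- B) \<ge> 1 / real (Suc n)" by blast
    then have "infdist x (- B) > 0" by (rule less_le_trans[rotated]) simp
    then show "x \<in> B" using infdist_zero[of x "- B"] by (cases "x \<in> B") auto
  next
    fix x assume x: "x \<in> B"
    have "- B \<noteq> {}" using False by blast
    with x have "infdist x (- B) \<noteq> 0"
      using in_closed_iff_infdist_zero[of "- B" x] assms by (simp add: closed_def)
    then have "infdist x (- B) > 0" using infdist_nonneg[of x "- B"] by linarith
    then obtain n where "1 / real (Suc n) < infdist x (- B)" by (rule nat_approx_posE)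
    then show "x \<in> (\<Union>n. {x. infdist x (- B) \<ge> 1 / real (Suc n)})" by (auto intro: less_imp_le)
  qed
  moreover have "\<And>n. souslin {x. infdist x (- B) \<ge> 1 / real (Suc n)}"
    by (intro souslin_closed closed_Collect_le continuous_intros)
  then have "souslin (\<Union>n. {x. infdist x (- B) \<ge> 1 / real (Suc n)})" by (rule souslin_UN)
  ultimately show ?thesis by (simp only:)
qed

text \<open>Analytic sets are in general not closed under complement, so the induction carries
  \<open>B\<close> and \<open>- B\<close> together and exchanges unions with intersections.\<close>

lemma souslin_borel:
  assumes "B \<in> sets (borel :: 'a::metric_space measure)"
  shows "souslin B \<and> souslin (- B)"
proof -
  have "B \<in> sigma_sets UNIV {S :: 'a set. open S}" using assms by (simp add: sets_borel)
  then show ?thesis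
  proof induction
    case (Basic S)
    then show ?case using souslin_open[of S] souslin_closed[of "- S"] by (auto simp: closed_def)
  next
    case Empty
    then show ?case by (simp add: souslin_closed)
  next
    case (Compl S)
    then show ?case by (simp add: Compl_eq_Diff_UNIV[symmetric])
  next
    case (Union S)
    then show ?case using souslin_UN[of S] souslin_INT[of "\<lambda>n. - S n"] by simp
  qed
qed

text \<open>A point of \<open>F\<close> is some \<open>x\<close> together with, for each
  \<open>n\<close>, a flag and a witness that the flag is the \<open>n\<close>-th bit of
  \<open>f x\<close>. Witnesses exist because both values of a bit have Souslin preimages;
  \<open>g\<close> merely reads the flags.\<close>

lemma borel_function_unfolding:
  fixes f :: "'a::metric_space \<Rightarrow> nat \<Rightarrow> bool"
  assumes f: "f \<in> borel_measurable borel"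
  obtains F :: "('a \<times> (nat \<Rightarrow> real)) set" and g :: "'a \<times> (nat \<Rightarrow> real) \<Rightarrow> nat \<Rightarrow> bool"
  where "closed F" "continuous_on F g" "\<forall>z\<in>F. g z = f (fst z)" "fst ` F = UNIV"
proof -
  have "f -` {e. e n} \<in> sets borel" for n
  proof -
    have "open {e :: nat \<Rightarrow> bool. e n}"
      using open_vimage[OF open_discrete[of "{True}"] continuous_on_product_coordinates[of n]]
      by (simp add: vimage_def)
    then have "{e :: nat \<Rightarrow> bool. e n} \<in> sets borel" by (rule borel_open)
    from measurable_sets[OF f this] show ?thesis by simp
  qed
  from souslin_borel[OF this] obtain F1 F0 :: "nat \<Rightarrow> ('a \<times> (nat \<Rightarrow> real)) set"
    where F: "\<And>n. closed (F1 n)" "\<And>n. closed (F0 n)"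
      "\<And>n. f -` {e. e n} = fst ` F1 n" "\<And>n. - (f -` {e. e n}) = fst ` F0 n"
    unfolding souslin_def by metis
  \<comment> \<open>Row \<open>n\<close> of the witness sequence has the flag as entry 0 and the
    witness after it.\<close>
  define h where "h = (\<lambda>n (z :: 'a \<times> (nat \<Rightarrow> real)). (fst z, \<lambda>k. snd z (prod_encode (n, Suc k))))"
  define b where "b = (\<lambda>n (z :: 'a \<times> (nat \<Rightarrow> real)). snd z (prod_encode (n, 0)))"
  define G where "G = (\<Inter>n. (b n -` {0} \<inter> h n -` F0 n) \<union> (b n -` {1} \<inter> h n -` F1 n))"
  define g where "g = (\<lambda>z n. b n z = 1)"
  have b: "continuous_on UNIV (b n)" for n unfolding b_def by (rule continuous_on_snd_coord)
  have h: "continuous_on UNIV (h n)" for n unfolding h_def by (rule continuous_on_reindex_snd)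
  have "closed G" unfolding G_def
    by (intro closed_INT ballI closed_Un closed_Int closed_vimage[OF closed_singleton b] closed_vimage[OF _ h] F)
  moreover have "continuous_on G g"
  proof (intro continuous_on_coordinatewise_then_product)
    fix n
    show "continuous_on G (\<lambda>z. g z n)"
      unfolding continuous_on_open_invariant
    proof (intro allI impI)
      fix S :: "bool set"
      \<comment> \<open>On \<open>G\<close> the flags are 0 or 1, so 1/2 separates them and an open
        half-line cuts out each value.\<close>
      define A where "A = (if True \<in> S then b n -` {1/2<..} else {}) \<union> (if False \<in> S then b n -` {..<1/2} else {})"
      have "open A" unfolding A_def by (auto intro!: open_Un open_vimage[OF _ b])
      moreover have "A \<inter> G = (\<lambda>z. g z n) -` S \<inter> G"
      proof (intro set_eqI)
        fix z
        show "z \<in> A \<inter> G \<longleftrightarrow> z \<in> (\<lambda>z. g z n) -` S \<inter> G"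
        proof (cases "z \<in> G")
          case True
          then have "b n z = 0 \<or> b n z = 1" unfolding G_def by blast
          then show ?thesis using True by (cases "b n z = 0") (auto simp: A_def g_def)
        qed simp
      qed
      ultimately show "\<exists>A. open A \<and> A \<inter> G = (\<lambda>z. g z n) -` S \<inter> G" by blast
    qed
  qed
  moreover have "\<forall>z\<in>G. g z = f (fst z)"
  proof (intro ballI ext)
    fix z n assume "z \<in> G"
    then have "(b n z = 0 \<and> h n z \<in> F0 n) \<or> (b n z = 1 \<and> h n z \<in> F1 n)"
      unfolding G_def by blast
    moreover have "fst (h n z) = fst z" by (simp add: h_def)
    moreover have "f (fst y) n" if "y \<in> F1 n" for y using F(3)[of n] that by blast
    moreover have "\<not> f (fst y) n" if "y \<in> F0 n" for y using F(4)[of n] that by blast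
    ultimately show "g z n = f (fst z) n" unfolding g_def by (metis zero_neq_one)
  qed
  moreover have "fst ` G = UNIV"
  proof -
    have "x \<in> fst ` G" for x
    proof -
      have "\<exists>v. (v 0 = (0::real) \<and> (x, \<lambda>k. v (Suc k)) \<in> F0 n) \<or> (v 0 = 1 \<and> (x, \<lambda>k. v (Suc k)) \<in> F1 n)" for n
      proof (cases "f x n")
        case True
        then have "x \<in> fst ` F1 n" by (simp flip: F(3))
        then obtain w where "(x, w) \<in> F1 n" by auto
        then show ?thesis by (intro exI[of _ "case_nat 1 w"]) simp
      next
        case False
        then have "x \<in> fst ` F0 n" by (simp flip: F(4))
        then obtain w where "(x, w) \<in> F0 n" by auto
        then show ?thesis by (intro exI[of _ "case_nat 0 w"]) simp
      qed
      then obtain v where v: "\<And>n. (v n 0 = (0::real) \<and> (x, \<lambda>k. v n (Suc k)) \<in> F0 n) \<or>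
          (v n 0 = 1 \<and> (x, \<lambda>k. v n (Suc k)) \<in> F1 n)" by metis
      have "(x, \<lambda>j. case prod_decode j of (n, k) \<Rightarrow> v n k) \<in> G"
        using v by (auto simp: G_def b_def h_def)
      then show ?thesis by (intro image_eqI[rotated]) auto
    qed
    then show ?thesis by blast
  qed
  ultimately show ?thesis using that by blast
qed

subsection \<open>The Pawlikowski function\<close>

definition pawlikowski_inv :: "(nat \<Rightarrow> nat) \<Rightarrow> (nat \<Rightarrow> enat)" where
  "pawlikowski_inv u n = (case u n of 0 \<Rightarrow> \<infinity> | Suc k \<Rightarrow> enat k)"

lemma pawlikowski_inverse [simp]: "pawlikowski (pawlikowski_inv u) = u"
  by (auto simp: pawlikowski_def pawlikowski_inv_def split: nat.splits)

lemma pawlikowski_inv_inverse [simp]: "pawlikowski_inv (pawlikowski x) = x"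
  by (auto simp: pawlikowski_def pawlikowski_inv_def split: enat.splits)

lemma open_cylinder: "open {v :: nat \<Rightarrow> 'b::discrete_topology. \<forall>i<n. v i = u i}"
proof -
  have "{v. \<forall>i<n. v i = u i} = (\<Inter>i\<in>{..<n}. (\<lambda>v. v i) -` {u i})" by auto
  moreover have "open ((\<lambda>v :: nat \<Rightarrow> 'b. v i) -` {u i})" for i
    by (rule open_vimage[OF open_discrete continuous_on_product_coordinates])
  ultimately show ?thesis by (auto intro!: open_INT)
qed

lemma open_contains_box:
  fixes U :: "(nat \<Rightarrow> 'b::topological_space) set"
  assumes "open U" "x \<in> U"
  obtains M and W :: "nat \<Rightarrow> 'b set"
  where "\<forall>i. open (W i) \<and> x i \<in> W i" "\<forall>y. (\<forall>i<M. y i \<in> W i) \<longrightarrow> y \<in> U"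
proof -
  have "openin (product_topology (\<lambda>i. euclidean) UNIV) U"
    using assms(1) by (simp add: open_fun_def)
  from product_topology_open_contains_basis[OF this assms(2)]
  obtain X where X: "x \<in> (\<Pi>\<^sub>E i\<in>UNIV. X i)" "\<And>i. open (X i)" "finite {i. X i \<noteq> UNIV}"
      "(\<Pi>\<^sub>E i\<in>UNIV. X i) \<subseteq> U"
    by (auto simp flip: open_openin)
  from X(3) obtain M where M: "\<And>i. X i \<noteq> UNIV \<Longrightarrow> i < M"
    unfolding finite_nat_set_iff_bounded by blast
  have "y \<in> U" if "\<forall>i<M. y i \<in> X i" for y
  proof -
    have "y i \<in> X i" for i using M[of i] that by (cases "X i = UNIV") auto
    then show ?thesis using X(4) by auto
  qed
  then show ?thesis using that[of X M] X(1,2) by auto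
qed

lemma open_contains_cylinder:
  fixes U :: "(nat \<Rightarrow> 'b::discrete_topology) set"
  assumes "open U" "u \<in> U"
  obtains n where "\<forall>v. (\<forall>i<n. v i = u i) \<longrightarrow> v \<in> U"
proof -
  obtain M W where "\<forall>i. open (W i) \<and> u i \<in> W i" "\<forall>y. (\<forall>i<M. y i \<in> W i) \<longrightarrow> y \<in> U"
    by (rule open_contains_box[OF assms])
  then show ?thesis using that[of M] by auto
qed

lemma not_sigma_continuous_pawlikowski: "\<not> sigma_continuous pawlikowski"
proof
  assume "sigma_continuous pawlikowski"
  then obtain A :: "nat \<Rightarrow> (nat \<Rightarrow> enat) set" where A: "(\<Union>n. A n) = UNIV \<and> (\<forall>n. continuous_on (A n) pawlikowski)"
    unfolding sigma_continuous_def by (elim exE)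
  then have cont: "continuous_on (A n) pawlikowski" for n by simp
  have step: "\<exists>v m'. m' > m \<and> (\<forall>i<m. v i = u i) \<and> (\<forall>y\<in>A n. \<exists>i<m'. y i \<noteq> v i)"
    for u :: "nat \<Rightarrow> enat" and m n
  \<comment> \<open>If no point of \<open>A n\<close> continues the prefix with
    \<open>\<infinity>\<close> at \<open>m\<close>, that prefix of length \<open>Suc m\<close>
    already avoids \<open>A n\<close>.\<close>
  proof (cases "\<exists>x\<in>A n. \<forall>i<Suc m. x i = (u(m := \<infinity>)) i")
    case False
    then have "\<forall>y\<in>A n. \<exists>i<Suc m. y i \<noteq> (u(m := \<infinity>)) i" by blast
    moreover have "\<forall>i<m. (u(m := \<infinity>)) i = u i" by simp
    ultimately show ?thesis using lessI[of m] by blast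
  next
    case True
    then obtain x where x': "x \<in> A n" "\<And>i. i < Suc m \<Longrightarrow> x i = (u(m := \<infinity>)) i" by blast
    have x: "x \<in> A n" "\<And>i. i < m \<Longrightarrow> x i = u i" "x m = \<infinity>"
      using x'(1) x'(2)[of m] x'(2) by (simp_all add: less_Suc_eq)
    \<comment> \<open>By continuity, the points of \<open>A n\<close> near \<open>x\<close> keep the
      value \<open>\<infinity>\<close> at \<open>m\<close>. A large finite value at \<open>m\<close>
      stays in the same box, so no continuation of the changed prefix can lie in
      \<open>A n\<close>.\<close>
    define S where "S = {w :: nat \<Rightarrow> nat. w m = 0}"
    have "open S"
      using open_vimage[OF open_discrete[of "{0}"] continuous_on_product_coordinates[of m]]
      by (simp add: vimage_def S_def)
    then obtain V where V: "open V" "V \<inter> A n = pawlikowski -` S \<inter> A n"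
      using cont[of n] unfolding continuous_on_open_invariant by blast
    have "pawlikowski x \<in> S" using x(3) by (simp add: S_def pawlikowski_def)
    then have "x \<in> V" using V(2) x(1) by blast
    obtain M W where W: "\<forall>i. open (W i) \<and> x i \<in> W i" "\<forall>y. (\<forall>i<M. y i \<in> W i) \<longrightarrow> y \<in> V"
      by (rule open_contains_box[OF V(1) \<open>x \<in> V\<close>])
    have "\<infinity> \<in> W m" using W(1) x(3) by metis
    then obtain k where k: "{enat k<..} \<subseteq> W m" using W(1) by (auto simp: open_enat_iff)
    define v where "v = x(m := enat (Suc k))"
    have "y \<notin> A n" if y: "\<And>i. i < max M (Suc m) \<Longrightarrow> y i = v i" for y
    proof
      assume yA: "y \<in> A n"
      have "v i \<in> W i" for i using W(1) k by (auto simp: v_def)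
      then have "y \<in> V" using W(2) y by simp
      then have "pawlikowski y \<in> S" using V(2) yA by blast
      then have "y m = \<infinity>" by (auto simp: S_def pawlikowski_def split: enat.splits)
      then show False using y[of m] by (simp add: v_def)
    qed
    then have "\<forall>y\<in>A n. \<exists>i<max M (Suc m). y i \<noteq> v i" by blast
    moreover have "\<forall>i<m. v i = u i" using x(2) by (simp add: v_def)
    moreover have "max M (Suc m) > m" by simp
    ultimately show ?thesis by blast
  qed
  define Q where "Q = (\<lambda>n (p :: (nat \<Rightarrow> enat) \<times> nat) p'. snd p' > snd p \<and> (\<forall>i<snd p. fst p' i = fst p i) \<and>
      (\<forall>y\<in>A n. \<exists>i<snd p'. y i \<noteq> fst p' i))"
  have "\<exists>s. \<forall>n. True \<and> Q n (s n) (s (Suc n))"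
  proof (rule dependent_nat_choice)
    fix p :: "(nat \<Rightarrow> enat) \<times> nat" and n
    from step[of "snd p" "fst p" n] obtain v m' where "m' > snd p" "\<forall>i<snd p. v i = fst p i"
        "\<forall>y\<in>A n. \<exists>i<m'. y i \<noteq> v i"
      by blast
    then show "\<exists>p'. True \<and> Q n p p'" by (intro exI[of _ "(v, m')"]) (simp add: Q_def)
  qed simp
  then obtain s where s: "\<And>n. Q n (s n) (s (Suc n))" by blast
  have mono: "n \<le> n' \<Longrightarrow> snd (s n) \<le> snd (s n') \<and> (\<forall>i<snd (s n). fst (s n') i = fst (s n) i)" for n n'
  proof (induction n' rule: dec_induct)
    case (step n')
    then show ?case using s[of n'] by (auto simp: Q_def)
  qed simp
  have ge: "n \<le> snd (s n)" for n
  proof (induction n)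
    case (Suc n)
    then show ?case using s[of n] by (auto simp: Q_def)
  qed simp
  \<comment> \<open>Prefix lengths grow strictly, so entry \<open>i\<close> is frozen from stage
    \<open>Suc i\<close> on.\<close>
  define x where "x = (\<lambda>i. fst (s (Suc i)) i)"
  have x: "x i = fst (s n) i" if "i < snd (s n)" for i n
  proof (cases "n \<le> Suc i")
    case True
    then show ?thesis using mono[OF True] that by (simp add: x_def)
  next
    case False
    then show ?thesis using mono[of "Suc i" n] ge[of "Suc i"] by (simp add: x_def)
  qed
  have "x \<notin> A n" for n
  proof
    assume "x \<in> A n"
    then obtain i where "i < snd (s (Suc n))" "x i \<noteq> fst (s (Suc n)) i"
      using s[of n] unfolding Q_def by blast
    then show False using x[of i "Suc n"] by blast
  qed
  then show False using A by blast
qed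

text \<open>Openness of \<psi> onto its range turns an open set of sequences into the trace of an
  open \<open>T\<close>. Its preimage under \<open>pawlikowski\<close> is thus that of
  \<open>T\<close> under \<open>f \<circ> \<phi>\<close>, which is continuous on the preimage of
  each \<open>A n\<close>.\<close>

lemma contains_pawlikowski_imp_not_sigma_continuous:
  assumes "contains_pawlikowski f"
  shows "\<not> sigma_continuous f"
proof
  assume "sigma_continuous f"
  then obtain A :: "nat \<Rightarrow> 'a set" where "(\<Union>n. A n) = UNIV \<and> (\<forall>n. continuous_on (A n) f)"
    unfolding sigma_continuous_def by (elim exE)
  then have A: "(\<Union>n. A n) = UNIV" "\<And>n. continuous_on (A n) f" by simp_all
  obtain \<psi> :: "(nat \<Rightarrow> nat) \<Rightarrow> (nat \<Rightarrow> bool)" and \<phi> :: "(nat \<Rightarrow> enat) \<Rightarrow> 'a"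
    where \<psi>: "open_injection \<psi>" and \<phi>: "continuous_on UNIV \<phi>" and comm: "\<psi> \<circ> pawlikowski = f \<circ> \<phi>"
    using assms unfolding contains_pawlikowski_def by (elim exE conjE) (rule that)
  have "continuous_on (\<phi> -` A n) pawlikowski" for n
    unfolding continuous_on_open_invariant
  proof (intro allI impI)
    fix U :: "(nat \<Rightarrow> nat) set" assume "open U"
    then have "openin (top_of_set (range \<psi>)) (\<psi> ` U)"
      using \<psi> by (simp add: open_injection_def open_map_def)
    then obtain T where T: "open T" "\<psi> ` U = range \<psi> \<inter> T" by (auto simp: openin_open)
    have "continuous_on (\<phi> -` A n) (f \<circ> \<phi>)"
      by (rule continuous_on_compose[OF continuous_on_subset[OF \<phi>] continuous_on_subset[OF A(2)]]) auto
    then obtain V where V: "open V" "V \<inter> \<phi> -` A n = (f \<circ> \<phi>) -` T \<inter> \<phi> -` A n"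
      using T(1) unfolding continuous_on_open_invariant by blast
    have "pawlikowski x \<in> U \<longleftrightarrow> \<psi> (pawlikowski x) \<in> T" for x
    proof -
      have "inj \<psi>" using \<psi> by (simp add: open_injection_def)
      then have "pawlikowski x \<in> U \<longleftrightarrow> \<psi> (pawlikowski x) \<in> \<psi> ` U" by (simp add: inj_image_mem_iff)
      then show ?thesis using T(2) by simp
    qed
    moreover have "(f \<circ> \<phi>) x = \<psi> (pawlikowski x)" for x using fun_cong[OF comm, of x] by simp
    ultimately have "pawlikowski -` U = (f \<circ> \<phi>) -` T" by auto
    then show "\<exists>V. open V \<and> V \<inter> \<phi> -` A n = pawlikowski -` U \<inter> \<phi> -` A n" using V by auto
  qed
  moreover have "(\<Union>n. \<phi> -` A n) = UNIV" using A(1) by blast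
  ultimately show False
    using not_sigma_continuous_pawlikowski
    unfolding sigma_continuous_def not_ex by (elim allE[of _ "\<lambda>n. \<phi> -` A n"]) simp
qed

subsection \<open>Null sets and chains\<close>

locale borel_unfolding =
  fixes f :: "'a::polish_space \<Rightarrow> nat \<Rightarrow> bool"
    and F :: "'z::{complete_space, second_countable_topology} set"
    and p :: "'z \<Rightarrow> 'a" and g :: "'z \<Rightarrow> nat \<Rightarrow> bool"
  assumes closed_F: "closed F" and cont_p: "continuous_on F p" and cont_g: "continuous_on F g"
    and g_eq: "\<And>z. z \<in> F \<Longrightarrow> g z = f (p z)" and p_onto: "p ` F = UNIV"
    and not_sigma: "\<not> sigma_continuous f"
begin

text \<open>The \<sigma>-ideal that measures progress. The covering sets live in the base space, so
  only the image of \<open>A\<close> under \<open>p\<close> matters.\<close>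

definition null :: "'z set \<Rightarrow> bool" where
  "null A \<longleftrightarrow> (\<exists>B :: nat \<Rightarrow> 'a set. p ` A \<subseteq> (\<Union>n. B n) \<and> (\<forall>n. continuous_on (B n) f))"

lemma null_subset: "null A \<Longrightarrow> B \<subseteq> A \<Longrightarrow> null B"
  unfolding null_def by (meson image_mono order_trans)

lemma null_continuous: "continuous_on (p ` A) f \<Longrightarrow> null A"
  unfolding null_def by (intro exI[of _ "\<lambda>_. p ` A"]) auto

lemma null_empty [simp]: "null {}"
  by (rule null_continuous) simp

lemma null_UN_nat:
  assumes "\<And>n::nat. null (A n)"
  shows "null (\<Union>n. A n)"
proof -
  have "\<forall>n. \<exists>B :: nat \<Rightarrow> 'a set. p ` A n \<subseteq> (\<Union>k. B k) \<and> (\<forall>k. continuous_on (B k) f)"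
    using assms by (simp add: null_def)
  from choice[OF this] obtain B :: "nat \<Rightarrow> nat \<Rightarrow> 'a set"
    where "\<forall>n. p ` A n \<subseteq> (\<Union>k. B n k) \<and> (\<forall>k. continuous_on (B n k) f)"
    by (elim exE)
  then have B: "\<And>n. p ` A n \<subseteq> (\<Union>k. B n k)" "\<And>n k. continuous_on (B n k) f" by simp_all
  have "p ` (\<Union>n. A n) \<subseteq> (\<Union>j. case prod_decode j of (n, k) \<Rightarrow> B n k)"
  proof
    fix x assume "x \<in> p ` (\<Union>n. A n)"
    then obtain n where "x \<in> p ` A n" by auto
    then have "x \<in> (\<Union>k. B n k)" using B(1)[of n] by (rule rev_subsetD)
    then obtain k where "x \<in> B n k" by auto
    then have "x \<in> (case prod_decode (prod_encode (n, k)) of (n, k) \<Rightarrow> B n k)" by simp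
    then show "x \<in> (\<Union>j. case prod_decode j of (n, k) \<Rightarrow> B n k)"
      by (rule UN_I[rotated]) simp
  qed
  moreover have "continuous_on (case prod_decode j of (n, k) \<Rightarrow> B n k) f" for j
    using B(2) by (simp split: prod.split)
  ultimately show ?thesis
    unfolding null_def by (intro exI[of _ "\<lambda>j. case prod_decode j of (n, k) \<Rightarrow> B n k"]) simp
qed

lemma null_UN:
  assumes "countable I" "\<And>i. i \<in> I \<Longrightarrow> null (A i)"
  shows "null (\<Union>i\<in>I. A i)"
proof (cases "I = {}")
  case False
  have "null (A (from_nat_into I n))" for n
    using assms(2) from_nat_into[OF False] by blast
  then have "null (\<Union>n. A (from_nat_into I n))" by (rule null_UN_nat)
  moreover have "(\<Union>i\<in>I. A i) = (\<Union>n. A (from_nat_into I n))"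
    using range_from_nat_into[OF False assms(1)] by (metis image_image)
  ultimately show ?thesis by simp
qed simp

lemma null_Un: "null A \<Longrightarrow> null B \<Longrightarrow> null (A \<union> B)"
  using null_UN[of "{True, False}" "\<lambda>b. if b then A else B"] by (simp add: Un_commute)

lemma null_fiber:
  assumes "A \<subseteq> F" "\<And>z. z \<in> A \<Longrightarrow> g z = d"
  shows "null A"
proof (rule null_continuous)
  have "\<And>x. x \<in> p ` A \<Longrightarrow> f x = d" using assms g_eq by fastforce
  then show "continuous_on (p ` A) f" by (simp cong: continuous_on_cong)
qed

lemma not_null_F: "\<not> null F"
proof
  assume "null F"
  then obtain B :: "nat \<Rightarrow> 'a set" where "UNIV \<subseteq> (\<Union>n. B n)" "\<And>n. continuous_on (B n) f"
    unfolding null_def p_onto by blast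
  then show False using not_sigma unfolding sigma_continuous_def by blast
qed

text \<open>Countably many basic open sets of small diameter cover the space, and null sets form a
  \<sigma>-ideal. With \<open>h\<close> the identity the piece is small in the unfolding, with
  \<open>h = p\<close> it is small in the base space.\<close>

lemma not_null_small_piece:
  fixes h :: "'z \<Rightarrow> 'c::{metric_space, second_countable_topology}"
  assumes "\<not> null A" "0 < \<epsilon>"
  obtains W where "open W" "\<forall>x\<in>W. \<forall>y\<in>W. dist x y \<le> \<epsilon>" "\<not> null (A \<inter> h -` W)"
proof -
  obtain \<B> :: "'c set set" where \<B>: "countable \<B>" "topological_basis \<B>"
    using ex_countable_basis by auto
  define \<W> where "\<W> = {W \<in> \<B>. \<forall>x\<in>W. \<forall>y\<in>W. dist x y \<le> \<epsilon>}"
  have "A \<subseteq> (\<Union>W\<in>\<W>. A \<inter> h -` W)"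
  proof
    fix z assume z: "z \<in> A"
    have "open (ball (h z) (\<epsilon> / 2))" "h z \<in> ball (h z) (\<epsilon> / 2)" using assms(2) by auto
    from topological_basisE[OF \<B>(2) this]
    obtain W where W: "W \<in> \<B>" "h z \<in> W" "W \<subseteq> ball (h z) (\<epsilon> / 2)" by blast
    have "dist x y \<le> \<epsilon>" if "x \<in> W" "y \<in> W" for x y
    proof -
      have "dist (h z) x < \<epsilon> / 2" "dist (h z) y < \<epsilon> / 2" using W(3) that by auto
      then show ?thesis using dist_triangle3[of x y "h z"] by linarith
    qed
    then show "z \<in> (\<Union>W\<in>\<W>. A \<inter> h -` W)" using W z by (auto simp: \<W>_def)
  qed
  moreover have "countable \<W>" using \<B>(1) by (simp add: \<W>_def)
  ultimately obtain W where "W \<in> \<W>" "\<not> null (A \<inter> h -` W)"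
    using null_UN[of \<W> "\<lambda>W. A \<inter> h -` W"] assms(1) null_subset by blast
  moreover have "open W" using \<open>W \<in> \<W>\<close> \<B>(2) by (auto simp: \<W>_def topological_basis_open)
  ultimately show ?thesis using that by (auto simp: \<W>_def)
qed

text \<open>
  The closure operator modulo the ideal of null sets, for the topology of \<open>X\<close> pulled back along \<open>p\<close>,
  which is coarser than the topology of the unfolding.
\<close>

definition star :: "'z set \<Rightarrow> 'z set" where
  "star A = {z. \<forall>W. open W \<longrightarrow> p z \<in> W \<longrightarrow> \<not> null (A \<inter> p -` W)}"

lemma starD: "z \<in> star A \<Longrightarrow> open W \<Longrightarrow> p z \<in> W \<Longrightarrow> \<not> null (A \<inter> p -` W)"
  by (simp add: star_def)

lemma star_mono: "A \<subseteq> B \<Longrightarrow> star A \<subseteq> star B"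
  unfolding star_def using null_subset by (smt (verit) Collect_mono Int_mono order_refl)

lemma star_star: "star (star A) \<subseteq> star A"
proof
  fix z assume z: "z \<in> star (star A)"
  have "\<not> null (A \<inter> p -` W)" if W: "open W" "p z \<in> W" for W
  proof -
    have "star A \<inter> p -` W \<noteq> {}" using starD[OF z W] by auto
    then obtain z' where "z' \<in> star A" "p z' \<in> W" by blast
    then show ?thesis using starD W(1) by blast
  qed
  then show "z \<in> star A" by (simp add: star_def)
qed

lemma star_Un: "star (A \<union> B) \<subseteq> star A \<union> star B"
proof
  fix z assume z: "z \<in> star (A \<union> B)"
  show "z \<in> star A \<union> star B"
  proof (rule ccontr)
    assume "z \<notin> star A \<union> star B"
    then obtain U W where U: "open U" "p z \<in> U" "null (A \<inter> p -` U)"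
      and W: "open W" "p z \<in> W" "null (B \<inter> p -` W)" unfolding star_def by blast
    have "null ((A \<union> B) \<inter> p -` (U \<inter> W))"
      by (rule null_subset[OF null_Un[OF U(3) W(3)]]) auto
    then show False using starD[OF z, of "U \<inter> W"] U W by auto
  qed
qed

lemma star_Int:
  assumes "z \<in> star A" "open W" "p z \<in> W"
  shows "z \<in> star (A \<inter> p -` W)"
proof -
  have "\<not> null (A \<inter> p -` W \<inter> p -` U)" if "open U" "p z \<in> U" for U
    using starD[OF assms(1), of "W \<inter> U"] assms that by (auto simp: Int_assoc)
  then show ?thesis by (simp add: star_def)
qed

lemma not_null_of_star:
  assumes "z \<in> star A" shows "\<not> null A"
  using starD[OF assms, of UNIV] by simp

text \<open>By compactness of the Cantor space this says that the images of \<open>A\<close> and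
  \<open>B\<close> under \<open>g\<close> have disjoint closures.\<close>

definition sep :: "'z set \<Rightarrow> 'z set \<Rightarrow> bool" where
  "sep A B \<longleftrightarrow> (\<exists>m. \<forall>z\<in>A. \<forall>z'\<in>B. \<exists>n<m. g z n \<noteq> g z' n)"

lemma sep_sym: "sep A B \<Longrightarrow> sep B A"
  unfolding sep_def by metis

lemma sep_mono: "sep A B \<Longrightarrow> A' \<subseteq> A \<Longrightarrow> B' \<subseteq> B \<Longrightarrow> sep A' B'"
  unfolding sep_def by (meson subsetD)

text \<open>For some bit \<open>n\<close> and value \<open>b\<close>, the part of
  \<open>D n b\<close> in the closure of the opposite piece is positive. Otherwise, removing all
  these parts and all null traces of the pieces on basic open sets leaves a set on whose image every
  bit of \<open>f\<close> is locally constant, so \<open>V\<close> would be null.\<close>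

lemma not_null_separated_pair:
  assumes "V \<subseteq> F" "\<not> null V"
  obtains A B where "A \<subseteq> V" "B \<subseteq> V" "B \<subseteq> star A" "\<not> null A" "\<not> null B" "sep A B"
proof -
  define D where "D = (\<lambda>n b. {z \<in> V. g z n = b})"
  have "\<exists>n b. \<not> null (D n b \<inter> star (D n (\<not> b)))"
  proof (rule ccontr)
    assume "\<not> ?thesis"
    then have N: "null (D n b \<inter> star (D n (\<not> b)))" for n b by blast
    obtain \<B> :: "'a set set" where \<B>: "countable \<B>" "topological_basis \<B>"
      using ex_countable_basis by auto
    define I where "I = {(W, n, b). W \<in> \<B> \<and> null (D n b \<inter> p -` W)}"
    have "countable (\<B> \<times> (UNIV :: (nat \<times> bool) set))" using \<B>(1) by simp
    then have cI: "countable I" by (rule countable_subset[rotated]) (auto simp: I_def)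
    define M1 where "M1 = (\<Union>(n, b)\<in>UNIV. D n b \<inter> star (D n (\<not> b)))"
    define M2 where "M2 = (\<Union>(W, n, b)\<in>I. D n b \<inter> p -` W)"
    have "null M1" unfolding M1_def by (rule null_UN) (use N in auto)
    moreover have "null M2" unfolding M2_def by (rule null_UN[OF cI]) (auto simp: I_def)
    moreover have "null (V - M1 - M2)"
    proof (rule null_continuous, rule continuous_on_coordinatewise_then_product)
      fix n
      show "continuous_on (p ` (V - M1 - M2)) (\<lambda>x. f x n)"
        unfolding continuous_on_topological
      proof (intro ballI allI impI)
        fix x and B :: "bool set"
        assume "x \<in> p ` (V - M1 - M2)" and B: "f x n \<in> B"
        then obtain z where z: "z \<in> V" "z \<notin> M1" "z \<notin> M2" "x = p z" by blast
        have "z \<in> D n (g z n)" using z(1) by (simp add: D_def)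
        then have "z \<notin> star (D n (\<not> g z n))" using z(2) unfolding M1_def by blast
        then obtain U where U: "open U" "p z \<in> U" "null (D n (\<not> g z n) \<inter> p -` U)"
          unfolding star_def by blast
        from topological_basisE[OF \<B>(2) U(1,2)]
        obtain W where W: "W \<in> \<B>" "p z \<in> W" "W \<subseteq> U" by blast
        \<comment> \<open>Within \<open>W\<close> the points with the opposite bit form a null
          trace, and \<open>M2\<close> has removed them.\<close>
        have "null (D n (\<not> g z n) \<inter> p -` W)" by (rule null_subset[OF U(3)]) (use W(3) in auto)
        then have WI: "(W, n, \<not> g z n) \<in> I" using W(1) by (simp add: I_def)
        have "f y n \<in> B" if y: "y \<in> p ` (V - M1 - M2)" "y \<in> W" for y
        proof -
          obtain z' where z': "z' \<in> V" "z' \<notin> M2" "y = p z'" using y(1) by blast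
          have "z' \<notin> D n (\<not> g z n)"
          proof
            assume "z' \<in> D n (\<not> g z n)"
            then have "z' \<in> M2" unfolding M2_def using WI y(2) z'(3) by blast
            then show False using z'(2) by blast
          qed
          then have "g z' n = g z n" using z'(1) by (auto simp: D_def)
          moreover have "z \<in> F" "z' \<in> F" using z(1) z'(1) assms(1) by auto
          ultimately have "f y n = f x n" using g_eq[of z] g_eq[of z'] z(4) z'(3) by simp
          then show ?thesis using B by simp
        qed
        then show "\<exists>A. open A \<and> x \<in> A \<and> (\<forall>y\<in>p ` (V - M1 - M2). y \<in> A \<longrightarrow> f y n \<in> B)"
          using W(1,2) z(4) topological_basis_open[OF \<B>(2)] by blast
      qed
    qed
    ultimately have "null (M1 \<union> M2 \<union> (V - M1 - M2))" by (intro null_Un)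
    then have "null V" by (rule null_subset) auto
    then show False using assms(2) by blast
  qed
  then obtain n b where nb: "\<not> null (D n b \<inter> star (D n (\<not> b)))" by blast
  show ?thesis
  proof (rule that[of "D n (\<not> b)" "D n b \<inter> star (D n (\<not> b))"])
    have "D n b \<inter> star (D n (\<not> b)) \<noteq> {}" using nb by auto
    then show "\<not> null (D n (\<not> b))" using not_null_of_star by blast
    show "sep (D n (\<not> b)) (D n b \<inter> star (D n (\<not> b)))"
      unfolding sep_def by (rule exI[of _ "Suc n"]) (auto simp: D_def)
  qed (use nb in \<open>auto simp: D_def\<close>)
qed

section \<open>Chains of reservoirs\<close>

text \<open>
  \<open>A j\<close> is the reservoir for the points whose \<open>j\<close>-th coordinate will turn out to be finite although
  it is treated as \<open>\<infinity>\<close> so far. Each reservoir lies in the closure of all earlier ones, so that a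
  small neighbourhood in \<open>X\<close> meets all of them in positive sets.
\<close>

definition chain :: "nat set \<Rightarrow> (nat \<Rightarrow> 'z set) \<Rightarrow> bool" where
  "chain J A \<longleftrightarrow> finite J \<and> (\<forall>j\<in>J. \<not> null (A j) \<and> A j \<subseteq> F) \<and>
     (\<forall>i\<in>J. \<forall>j\<in>J. i < j \<longrightarrow> A j \<subseteq> star (A i))"

text \<open>Distances are taken in the unfolding. As the bound is governed by the smaller index, the
  union of all reservoirs from index \<open>i\<close> on has diameter at most
  \<open>(1/2) ^ i\<close>, while earlier ones may be far away.\<close>

definition tight :: "nat set \<Rightarrow> (nat \<Rightarrow> 'z set) \<Rightarrow> bool" where
  "tight J A \<longleftrightarrow> (\<forall>i\<in>J. \<forall>j\<in>J. i \<le> j \<longrightarrow> (\<forall>z\<in>A i. \<forall>z'\<in>A j. dist z z' \<le> (1/2) ^ i))"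

lemma tight_mono: "tight J A \<Longrightarrow> (\<And>j. j \<in> J \<Longrightarrow> A' j \<subseteq> A j) \<Longrightarrow> tight J A'"
  unfolding tight_def by (meson subsetD)

text \<open>Positivity travels downwards: the last reservoir is nonempty and lies in the closure of
  every earlier one.\<close>

lemma chain_positive_last:
  assumes "finite J" "J \<noteq> {}" "\<And>i j. i \<in> J \<Longrightarrow> j \<in> J \<Longrightarrow> i < j \<Longrightarrow> A j \<subseteq> star (A i)"
    "\<And>j. j \<in> J \<Longrightarrow> A j \<subseteq> F" "\<not> null (A (Max J))"
  shows "chain J A"
proof -
  have "\<not> null (A j)" if "j \<in> J" for j
  proof (cases "j = Max J")
    case False
    then have "j < Max J" using that assms(1) by (simp add: order_le_neq_trans)
    then have "A (Max J) \<subseteq> star (A j)" using assms that by simp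
    moreover have "A (Max J) \<noteq> {}" using assms(5) by auto
    ultimately show ?thesis using not_null_of_star by blast
  qed (use assms in simp)
  then show ?thesis using assms by (simp add: chain_def)
qed

text \<open>Indices are added from below. A piece of \<open>V\<close> of diameter at most
  \<open>(1/2) ^ b\<close> contains a separated pair; one half becomes reservoir \<open>b\<close>,
  and the chain for the larger indices is built inside the other half, which lies in its
  closure.\<close>

lemma fresh_chain:
  assumes "finite J" "V \<subseteq> F" "\<not> null V"
  shows "\<exists>A. chain J A \<and> tight J A \<and> (\<forall>j\<in>J. A j \<subseteq> V) \<and> (\<forall>i\<in>J. \<forall>j\<in>J. i \<noteq> j \<longrightarrow> sep (A i) (A j))"
  using assms
proof (induction J arbitrary: V rule: finite_linorder_min_induct)
  case empty
  then show ?case by (simp add: chain_def tight_def)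
next
  case (insert b J)
  have "(0 :: real) < (1/2) ^ b" by simp
  then obtain W :: "'z set" where "open W" and W: "\<forall>x\<in>W. \<forall>y\<in>W. dist x y \<le> (1/2) ^ b"
    "\<not> null (V \<inter> (\<lambda>z. z) -` W)"
    by (rule not_null_small_piece[OF insert.prems(2), where h = "\<lambda>z. z"])
  have "V \<inter> W \<subseteq> F" "\<not> null (V \<inter> W)" using W(2) insert.prems(1) by auto
  then obtain A B where AB: "A \<subseteq> V \<inter> W" "B \<subseteq> V \<inter> W" "B \<subseteq> star A" "\<not> null A" "\<not> null B" "sep A B"
    by (rule not_null_separated_pair)
  have "B \<subseteq> F" using AB(2) insert.prems(1) by blast
  from insert.IH[OF this AB(5)] obtain C where C': "chain J C" "tight J C" "\<forall>j\<in>J. C j \<subseteq> B"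
    "\<forall>i\<in>J. \<forall>j\<in>J. i \<noteq> j \<longrightarrow> sep (C i) (C j)"
    by (elim exE conjE)
  have C: "chain J C" "tight J C" "\<And>j. j \<in> J \<Longrightarrow> C j \<subseteq> B"
    "\<And>i j. i \<in> J \<Longrightarrow> j \<in> J \<Longrightarrow> i \<noteq> j \<Longrightarrow> sep (C i) (C j)"
    using C' by simp_all
  let ?A = "C(b := A)"
  have b: "b \<notin> J" "\<And>j. j \<in> J \<Longrightarrow> b < j" using insert.hyps by auto
  have CA: "sep A (C j)" if "j \<in> J" for j using sep_mono[OF AB(6) order_refl C(3)[OF that]] .
  have "chain (insert b J) ?A"
    unfolding chain_def
  proof (intro conjI ballI impI)
    show "finite (insert b J)" using insert.hyps by simp
    fix j assume j: "j \<in> insert b J"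
    have "A \<subseteq> F" using AB(1) insert.prems(1) by blast
    then show "\<not> null (?A j)" "?A j \<subseteq> F" using j b AB(4) C(1) unfolding chain_def by auto
    fix i assume i: "i \<in> insert b J" "i < j"
    have "j \<noteq> b" using i b(2)[of i] by auto
    then have jJ: "j \<in> J" using j by simp
    show "?A j \<subseteq> star (?A i)"
    proof (cases "i = b")
      case True
      then show ?thesis using C(3)[OF jJ] AB(3) \<open>j \<noteq> b\<close> by auto
    next
      case False
      then show ?thesis using i jJ \<open>j \<noteq> b\<close> C(1) by (simp add: chain_def)
    qed
  qed
  moreover have "tight (insert b J) ?A"
    unfolding tight_def
  proof (intro ballI impI)
    fix i j z z' assume *: "i \<in> insert b J" "j \<in> insert b J" "i \<le> j" "z \<in> ?A i" "z' \<in> ?A j"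
    show "dist z z' \<le> (1/2) ^ i"
    proof (cases "i = b")
      case True
      have "z \<in> W" using True *(4) AB(1) by auto
      moreover have "z' \<in> W"
      proof (cases "j = b")
        case True
        then show ?thesis using *(5) AB(1) by auto
      next
        case False
        then show ?thesis using *(2,5) C(3)[of j] AB(2) by auto
      qed
      ultimately show ?thesis using True W(1) by blast
    next
      case False
      then have "i \<in> J" using *(1) by simp
      moreover have "j \<noteq> b" using *(3) b(2)[OF \<open>i \<in> J\<close>] by simp
      moreover have "j \<in> J" using *(2) \<open>j \<noteq> b\<close> by simp
      ultimately show ?thesis using False *(3,4,5) C(2) unfolding tight_def by simp
    qed
  qed
  moreover have "\<forall>j\<in>insert b J. ?A j \<subseteq> V"
  proof
    fix j assume "j \<in> insert b J"
    then show "?A j \<subseteq> V" using AB(1,2) C(3)[of j] by (cases "j = b") auto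
  qed
  moreover have "\<forall>i\<in>insert b J. \<forall>j\<in>insert b J. i \<noteq> j \<longrightarrow> sep (?A i) (?A j)"
    using CA C(4) sep_sym[OF CA] b by auto
  ultimately show ?case by (intro exI[of _ ?A] conjI)
qed

text \<open>It suffices to keep the last reservoir positive: intersecting with the preimage of an
  open set preserves the closure relations.\<close>

lemma chain_small:
  assumes "chain J A" "0 < \<epsilon>"
  obtains W where "\<forall>x\<in>W. \<forall>y\<in>W. dist x y \<le> \<epsilon>" "chain J (\<lambda>j. A j \<inter> p -` W)"
proof (cases "J = {}")
  case True
  then show ?thesis using that[of "{}"] by (simp add: chain_def)
next
  case False
  have J: "finite J" "Max J \<in> J" using assms(1) False by (auto simp: chain_def)
  then have "\<not> null (A (Max J))" using assms(1) by (simp add: chain_def)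
  from not_null_small_piece[OF this assms(2), of p]
  obtain W where W: "open W" "\<forall>x\<in>W. \<forall>y\<in>W. dist x y \<le> \<epsilon>" "\<not> null (A (Max J) \<inter> p -` W)" .
  have "chain J (\<lambda>j. A j \<inter> p -` W)"
  proof (rule chain_positive_last[OF J(1) False])
    fix i j assume *: "i \<in> J" "j \<in> J" "i < j"
    show "A j \<inter> p -` W \<subseteq> star (A i \<inter> p -` W)"
      using star_Int[OF _ W(1)] assms(1) * unfolding chain_def by blast
  next
    show "A j \<inter> p -` W \<subseteq> F" if "j \<in> J" for j using assms(1) that unfolding chain_def by blast
  qed (rule W(3))
  then show ?thesis using that W(2) by blast
qed

text \<open>A fresh chain inside \<open>S\<close> replaces everything from index \<open>i\<close>
  on. It still fits on top of the earlier reservoirs, because they have \<open>A i\<close> in their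
  closures.\<close>

lemma chain_tail:
  assumes A: "chain J A" "tight J A" and i: "i \<in> J" and S: "S \<subseteq> A i" "\<not> null S"
    and K: "finite K" "\<And>k. k \<in> K \<Longrightarrow> i \<le> k"
  shows "\<exists>A'. chain ({j \<in> J. j < i} \<union> K) A' \<and> tight ({j \<in> J. j < i} \<union> K) A' \<and>
    (\<forall>j<i. A' j = A j) \<and> (\<forall>j\<in>K. A' j \<subseteq> S) \<and> (\<forall>j\<in>K. \<forall>j'\<in>K. j \<noteq> j' \<longrightarrow> sep (A' j) (A' j'))"
proof -
  have "S \<subseteq> F" using A(1) i S(1) unfolding chain_def by blast
  from fresh_chain[OF K(1) this S(2)] obtain B where B': "chain K B" "tight K B" "\<forall>j\<in>K. B j \<subseteq> S"
    "\<forall>j\<in>K. \<forall>j'\<in>K. j \<noteq> j' \<longrightarrow> sep (B j) (B j')"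
    by (elim exE conjE)
  have B: "chain K B" "tight K B" "\<And>j. j \<in> K \<Longrightarrow> B j \<subseteq> S"
    "\<And>j j'. j \<in> K \<Longrightarrow> j' \<in> K \<Longrightarrow> j \<noteq> j' \<Longrightarrow> sep (B j) (B j')"
    using B' by simp_all
  define A' where "A' = (\<lambda>j. if j < i then A j else B j)"
  have K': "\<And>k. k \<in> K \<Longrightarrow> \<not> k < i" using K(2) by force
  let ?J = "{j \<in> J. j < i} \<union> K"
  have BA: "B j \<subseteq> A i" if "j \<in> K" for j using B(3)[OF that] S(1) by blast
  have "chain ?J A'"
    unfolding chain_def
  proof (intro conjI ballI impI)
    show "finite ?J" using A(1) K(1) by (simp add: chain_def)
    fix j assume j: "j \<in> ?J"
    show "\<not> null (A' j)" "A' j \<subseteq> F" using j A(1) B(1) K' by (auto simp: A'_def chain_def)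
    fix l assume l: "l \<in> ?J" "l < j"
    consider "j < i" | "l < i" "j \<in> K" | "l \<in> K" "j \<in> K" using l j K(2) by force
    then show "A' j \<subseteq> star (A' l)"
    proof cases
      case 1
      then have "l \<in> J" "j \<in> J" using l j K'[of l] K'[of j] by auto
      then show ?thesis using 1 l(2) A(1) by (simp add: A'_def chain_def)
    next
      case 2
      then have "A i \<subseteq> star (A l)" using A(1) i l K' unfolding chain_def by blast
      then show ?thesis using 2 BA[OF 2(2)] K' by (auto simp: A'_def)
    next
      case 3
      then show ?thesis using l(2) B(1) K' by (auto simp: A'_def chain_def)
    qed
  qed
  moreover have "tight ?J A'"
    unfolding tight_def
  proof (intro ballI impI)
    fix l j z z' assume *: "l \<in> ?J" "j \<in> ?J" "l \<le> j" "z \<in> A' l" "z' \<in> A' j"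
    consider "l < i" "l \<in> J" "j < i" "j \<in> J" | "l < i" "l \<in> J" "j \<in> K" | "l \<in> K" "j \<in> K"
      using * K' K(2) by force
    then show "dist z z' \<le> (1/2) ^ l"
    proof cases
      case 1
      then show ?thesis using * A(2) by (simp add: A'_def tight_def)
    next
      case 2
      then have "z' \<in> A i" using * BA K' by (auto simp: A'_def)
      moreover have "z \<in> A l" using 2 * by (simp add: A'_def)
      ultimately show ?thesis using 2 A(2) i unfolding tight_def by (meson less_imp_le)
    next
      case 3
      then show ?thesis using * B(2) K' by (simp add: A'_def tight_def)
    qed
  qed
  moreover have "\<forall>j<i. A' j = A j" by (simp add: A'_def)
  moreover have "\<forall>j\<in>K. A' j \<subseteq> S" using B(3) K' by (auto simp: A'_def)
  moreover have "\<forall>j\<in>K. \<forall>j'\<in>K. j \<noteq> j' \<longrightarrow> sep (A' j) (A' j')" using B(4) K' by (simp add: A'_def)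
  ultimately show ?thesis by (intro exI[of _ A']) simp
qed

text \<open>
  Cutting the reservoir \<open>A i\<close> in two forces cuts of all later ones: closures commute with unions,
  so every later reservoir is covered by the closures of the two pieces of its predecessor.
\<close>

lemma star_chain_split:
  fixes A :: "nat \<Rightarrow> 'z set"
  assumes "finite J" "\<And>l j. l \<in> J \<Longrightarrow> j \<in> J \<Longrightarrow> l < j \<Longrightarrow> A j \<subseteq> star (A l)"
    "i \<in> J \<or> (\<forall>j\<in>J. j < i)" "A i \<subseteq> P \<union> Q"
  shows "\<exists>X Y. (\<forall>j. X j \<subseteq> A j \<and> Y j \<subseteq> A j) \<and> X i \<subseteq> P \<and> Y i \<subseteq> Q \<and>
    (\<forall>l\<in>J. \<forall>j\<in>J. l < j \<longrightarrow> X j \<subseteq> star (X l) \<and> Y j \<subseteq> star (Y l)) \<and>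
    (\<forall>j<i. X j = A j \<and> Y j = A j) \<and> (\<forall>j\<in>insert i J. A j \<subseteq> X j \<union> Y j)"
  using assms
proof (induction J rule: finite_linorder_max_induct)
  case empty
  show ?case
  proof (rule exI[of _ "A(i := A i \<inter> P)"], rule exI[of _ "A(i := A i \<inter> Q)"], intro conjI ballI allI impI)
    fix j assume "j \<in> insert i ({} :: nat set)"
    then show "A j \<subseteq> (A(i := A i \<inter> P)) j \<union> (A(i := A i \<inter> Q)) j" using empty(3) by auto
  qed auto
next
  case (insert b J)
  have "i \<in> J \<or> (\<forall>j\<in>J. j < i)" using insert.prems(2) insert.hyps(2) by auto
  moreover have "\<And>l j. l \<in> J \<Longrightarrow> j \<in> J \<Longrightarrow> l < j \<Longrightarrow> A j \<subseteq> star (A l)" using insert.prems(1) by simp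
  ultimately have "\<exists>X Y. (\<forall>j. X j \<subseteq> A j \<and> Y j \<subseteq> A j) \<and> X i \<subseteq> P \<and> Y i \<subseteq> Q \<and>
    (\<forall>l\<in>J. \<forall>j\<in>J. l < j \<longrightarrow> X j \<subseteq> star (X l) \<and> Y j \<subseteq> star (Y l)) \<and>
    (\<forall>j<i. X j = A j \<and> Y j = A j) \<and> (\<forall>j\<in>insert i J. A j \<subseteq> X j \<union> Y j)"
    using insert.prems(3) by (intro insert.IH) simp_all
  then obtain X Y where XY':
    "\<forall>j. X j \<subseteq> A j \<and> Y j \<subseteq> A j" "X i \<subseteq> P" "Y i \<subseteq> Q"
    "\<forall>l\<in>J. \<forall>j\<in>J. l < j \<longrightarrow> X j \<subseteq> star (X l) \<and> Y j \<subseteq> star (Y l)"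
    "\<forall>j<i. X j = A j \<and> Y j = A j" "\<forall>j\<in>insert i J. A j \<subseteq> X j \<union> Y j"
    by (elim exE conjE)
  have XY: "\<And>j. X j \<subseteq> A j" "\<And>j. Y j \<subseteq> A j"
    "X i \<subseteq> P" "Y i \<subseteq> Q" "\<And>l j. l \<in> J \<Longrightarrow> j \<in> J \<Longrightarrow> l < j \<Longrightarrow> X j \<subseteq> star (X l)"
    "\<And>l j. l \<in> J \<Longrightarrow> j \<in> J \<Longrightarrow> l < j \<Longrightarrow> Y j \<subseteq> star (Y l)"
    "\<And>j. j < i \<Longrightarrow> X j = A j" "\<And>j. j < i \<Longrightarrow> Y j = A j"
    using XY'(1-5) by simp_all
  have cov: "A j \<subseteq> X j \<union> Y j" if "j \<in> insert i J" for j using XY'(6) that by (rule bspec)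
  have b: "b \<notin> J" "\<And>j. j \<in> J \<Longrightarrow> j < b" using insert.hyps by auto
  show ?case
  \<comment> \<open>Reservoirs below \<open>i\<close> are not cut, so up to \<open>b = i\<close> the
    sets of the induction hypothesis serve unchanged.\<close>
  proof (cases "b \<le> i")
    case True
    have *: "X b \<subseteq> star (X l) \<and> Y b \<subseteq> star (Y l)" if "l \<in> J" for l
    proof -
      have "l < i" using b(2)[OF that] True by simp
      moreover have "A b \<subseteq> star (A l)" using insert.prems(1) b(2) that by simp
      ultimately show ?thesis using XY(1)[of b] XY(2)[of b] XY(7,8)[of l] by (simp add: subset_trans[of _ "A b"])
    qed
    have "\<forall>l\<in>insert b J. \<forall>j\<in>insert b J. l < j \<longrightarrow> X j \<subseteq> star (X l) \<and> Y j \<subseteq> star (Y l)"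
    proof (intro ballI impI)
      fix l j assume lj: "l \<in> insert b J" "j \<in> insert b J" "l < j"
      then have "l \<in> J" using b(2)[of j] by auto
      then show "X j \<subseteq> star (X l) \<and> Y j \<subseteq> star (Y l)"
        using * XY(5,6) lj by (cases "j = b") auto
    qed
    moreover have "A b \<subseteq> X b \<union> Y b" using XY(7)[of b] cov[of b] True by (cases "b = i") simp_all
    then have "\<forall>j\<in>insert i (insert b J). A j \<subseteq> X j \<union> Y j" using XY'(6) by blast
    ultimately show ?thesis
      using XY' by - (rule exI[of _ X], rule exI[of _ Y], intro conjI)
  next
    case False
    then have i: "i \<in> J" using insert.prems(2) by auto
    define m where "m = Max J"
    have m: "m \<in> J" "\<And>l. l \<in> J \<Longrightarrow> l \<le> m" using insert.hyps(1) i by (auto simp: m_def intro: Max_in)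
    have X: "star (X m) \<subseteq> star (X l)" if "l \<in> J" for l
    proof (cases "l = m")
      case False
      then have "l < m" using m(2)[OF that] by simp
      then show ?thesis using star_mono[OF XY(5)[OF that m(1)]] star_star by blast
    qed simp
    have Y: "star (Y m) \<subseteq> star (Y l)" if "l \<in> J" for l
    proof (cases "l = m")
      case False
      then have "l < m" using m(2)[OF that] by simp
      then show ?thesis using star_mono[OF XY(6)[OF that m(1)]] star_star by blast
    qed simp
    \<comment> \<open>Only the closure of the largest earlier piece is imposed:
      \<open>star_star\<close> places it inside the closures of all the others.\<close>
    define X' where "X' = X(b := A b \<inter> star (X m))"
    define Y' where "Y' = Y(b := A b \<inter> star (Y m))"
    have "A b \<subseteq> star (A m)" using insert.prems(1) m(1) b by simp
    also have "\<dots> \<subseteq> star (X m \<union> Y m)" using cov[of m] m(1) by (intro star_mono) simp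
    also have "\<dots> \<subseteq> star (X m) \<union> star (Y m)" by (rule star_Un)
    finally have cover: "A b \<subseteq> X' b \<union> Y' b" by (auto simp: X'_def Y'_def)
    have "\<forall>l\<in>insert b J. \<forall>j\<in>insert b J. l < j \<longrightarrow> X' j \<subseteq> star (X' l) \<and> Y' j \<subseteq> star (Y' l)"
    proof (intro ballI impI)
      fix l j assume *: "l \<in> insert b J" "j \<in> insert b J" "l < j"
      then have l: "l \<in> J" "l \<noteq> b" using b by force+
      show "X' j \<subseteq> star (X' l) \<and> Y' j \<subseteq> star (Y' l)"
      proof (cases "j = b")
        case True
        then show ?thesis using l X[OF l(1)] Y[OF l(1)] by (auto simp: X'_def Y'_def)
      next
        case False
        then show ?thesis using l * XY(5,6) by (simp add: X'_def Y'_def)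
      qed
    qed
    moreover have "\<forall>j. X' j \<subseteq> A j \<and> Y' j \<subseteq> A j" using XY(1,2) by (simp add: X'_def Y'_def)
    moreover have "X' i \<subseteq> P" "Y' i \<subseteq> Q" using XY(3,4) False by (auto simp: X'_def Y'_def)
    moreover have "\<forall>j<i. X' j = A j \<and> Y' j = A j" using XY(7,8) False by (simp add: X'_def Y'_def)
    moreover have "\<forall>j\<in>insert i (insert b J). A j \<subseteq> X' j \<union> Y' j"
    proof
      fix j assume "j \<in> insert i (insert b J)"
      then show "A j \<subseteq> X' j \<union> Y' j" using cover cov[of j] by (cases "j = b") (auto simp: X'_def Y'_def)
    qed
    ultimately show ?thesis by - (rule exI[of _ X'], rule exI[of _ Y'], intro conjI)
  qed
qed

text \<open>The two pieces of the last reservoir cover it, so one is positive, which makes its whole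
  family a chain.\<close>

lemma chain_split:
  assumes "chain J A" "i \<in> J" "A i \<subseteq> P \<union> Q"
  shows "\<exists>A'. chain J A' \<and> (\<forall>j. A' j \<subseteq> A j) \<and> (A' i \<subseteq> P \<or> A' i \<subseteq> Q)"
proof -
  have J: "finite J" "J \<noteq> {}" using assms by (auto simp: chain_def)
  have st: "\<And>l j. l \<in> J \<Longrightarrow> j \<in> J \<Longrightarrow> l < j \<Longrightarrow> A j \<subseteq> star (A l)"
    using assms(1) by (simp add: chain_def)
  have "\<exists>X Y. (\<forall>j. X j \<subseteq> A j \<and> Y j \<subseteq> A j) \<and> X i \<subseteq> P \<and> Y i \<subseteq> Q \<and>
    (\<forall>l\<in>J. \<forall>j\<in>J. l < j \<longrightarrow> X j \<subseteq> star (X l) \<and> Y j \<subseteq> star (Y l)) \<and>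
    (\<forall>j<i. X j = A j \<and> Y j = A j) \<and> (\<forall>j\<in>insert i J. A j \<subseteq> X j \<union> Y j)"
    by (rule star_chain_split) (use J(1) st assms(2,3) in simp_all)
  then obtain X Y where XY':
    "\<forall>j. X j \<subseteq> A j \<and> Y j \<subseteq> A j" "X i \<subseteq> P" "Y i \<subseteq> Q"
    "\<forall>l\<in>J. \<forall>j\<in>J. l < j \<longrightarrow> X j \<subseteq> star (X l) \<and> Y j \<subseteq> star (Y l)"
    "\<forall>j\<in>insert i J. A j \<subseteq> X j \<union> Y j"
    by (elim exE conjE)
  have XY: "\<And>j. X j \<subseteq> A j" "\<And>j. Y j \<subseteq> A j"
    "X i \<subseteq> P" "Y i \<subseteq> Q" "\<And>l j. l \<in> J \<Longrightarrow> j \<in> J \<Longrightarrow> l < j \<Longrightarrow> X j \<subseteq> star (X l)"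
    "\<And>l j. l \<in> J \<Longrightarrow> j \<in> J \<Longrightarrow> l < j \<Longrightarrow> Y j \<subseteq> star (Y l)"
    using XY'(1-4) by simp_all
  have cov: "A j \<subseteq> X j \<union> Y j" if "j \<in> insert i J" for j using XY'(5) that by (rule bspec)
  have F: "A j \<subseteq> F" if "j \<in> J" for j using assms(1) that by (simp add: chain_def)
  have "\<not> null (A (Max J))" "Max J \<in> insert i J" using assms(1) J by (auto simp: chain_def)
  then have "\<not> null (X (Max J)) \<or> \<not> null (Y (Max J))"
    using null_subset[OF null_Un cov[of "Max J"]] by blast
  then show ?thesis
  proof
    assume "\<not> null (X (Max J))"
    moreover have "X j \<subseteq> F" if "j \<in> J" for j using XY(1)[of j] F[OF that] by blast
    ultimately have "chain J X" using XY(5) by (intro chain_positive_last[OF J])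
    then show ?thesis using XY(1,3) by blast
  next
    assume "\<not> null (Y (Max J))"
    moreover have "Y j \<subseteq> F" if "j \<in> J" for j using XY(2)[of j] F[OF that] by blast
    ultimately have "chain J Y" using XY(6) by (intro chain_positive_last[OF J])
    then show ?thesis using XY(2,4) by blast
  qed
qed

text \<open>Bits of reservoir \<open>i\<close> are fixed one after another by splitting. The value
  \<open>d\<close> is a branch of the resulting tree: every finite part of it is realized by some
  subchain, but the subchain depends on the length.\<close>

lemma chain_localize:
  assumes "chain J A" "i \<in> J"
  shows "\<exists>d. \<forall>m. \<exists>A'. chain J A' \<and> (\<forall>j. A' j \<subseteq> A j) \<and> (\<forall>z\<in>A' i. \<forall>n<m. g z n = d n)"
proof -
  define good where "good = (\<lambda>m e. \<exists>A'. chain J A' \<and> (\<forall>j. A' j \<subseteq> A j) \<and> (\<forall>z\<in>A' i. \<forall>n<m. g z n = e n))"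
  have "\<exists>e. \<forall>m. good m (e m) \<and> (\<forall>n<m. e (Suc m) n = e m n)"
  proof (rule dependent_nat_choice)
    show "\<exists>e. good 0 e" using assms(1) by (auto simp: good_def)
  next
    fix e m assume "good m e"
    then obtain A' where A': "chain J A'" "\<forall>j. A' j \<subseteq> A j" "\<forall>z\<in>A' i. \<forall>n<m. g z n = e n"
      unfolding good_def by (elim exE conjE)
    have "A' i \<subseteq> {z. g z m} \<union> {z. \<not> g z m}" by blast
    from chain_split[OF A'(1) assms(2) this]
    obtain B where B: "chain J B" "\<forall>j. B j \<subseteq> A' j" "B i \<subseteq> {z. g z m} \<or> B i \<subseteq> {z. \<not> g z m}"
      by (elim exE conjE)
    from B(3) have "\<exists>b. \<forall>z\<in>B i. g z m = b" by auto
    then obtain b where b: "\<forall>z\<in>B i. g z m = b" by (elim exE)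
    have "good (Suc m) (e(m := b))"
      unfolding good_def
    proof (intro exI[of _ B] conjI allI ballI impI)
      show "B j \<subseteq> A j" for j using A'(2) B(2) by blast
      fix z n assume "z \<in> B i" "n < Suc m"
      moreover have "z \<in> A' i" using \<open>z \<in> B i\<close> B(2) by blast
      ultimately show "g z n = (e(m := b)) n" using b A'(3) by (cases "n = m") auto
    qed (rule B(1))
    then show "\<exists>e'. good (Suc m) e' \<and> (\<forall>n<m. e' n = e n)" by (intro exI[of _ "e(m := b)"]) simp
  qed
  then obtain e where e': "\<forall>m. good m (e m) \<and> (\<forall>n<m. e (Suc m) n = e m n)" by (elim exE)
  then have e: "good m (e m)" "n < m \<Longrightarrow> e (Suc m) n = e m n" for m n by simp_all
  have e_eq: "e m n = e (Suc n) n" if "n < m" for m n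
    using that
  proof (induction m)
    case (Suc m)
    then show ?case using e(2)[of n m] by (cases "n = m") auto
  qed simp
  \<comment> \<open>Later prefixes never change earlier bits, so the diagonal extends every
    \<open>e m\<close>.\<close>
  have "good m (\<lambda>n. e (Suc n) n)" for m using e(1)[of m] e_eq[of _ m] unfolding good_def by simp
  then show ?thesis unfolding good_def by (intro exI[of _ "\<lambda>n. e (Suc n) n"] allI)
qed

text \<open>Countably many null cylinders and finitely many null fibres do not exhaust
  \<open>V\<close>; the value at any remaining point works.\<close>

lemma generic_value:
  assumes "V \<subseteq> F" "\<not> null V" "finite T"
  shows "\<exists>e. e \<notin> T \<and> (\<forall>m. \<not> null {z \<in> V. \<forall>n<m. g z n = e n})"
proof -
  define cyl where "cyl = (\<lambda>xs :: bool list. {z \<in> V. \<forall>n<length xs. g z n = xs ! n})"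
  define M where "M = (\<Union>xs\<in>{xs. null (cyl xs)}. cyl xs)"
  have "null M" unfolding M_def by (rule null_UN) auto
  moreover have "null (\<Union>e\<in>T. {z \<in> V. g z = e})"
    using assms(1,3) by (intro null_UN countable_finite null_fiber) auto
  ultimately have "\<not> V \<subseteq> M \<union> (\<Union>e\<in>T. {z \<in> V. g z = e})"
    using assms(2) null_Un null_subset by blast
  then obtain z where z: "z \<in> V" "z \<notin> M" "g z \<notin> T" by blast
  have "\<not> null {z' \<in> V. \<forall>n<m. g z' n = g z n}" for m
  proof -
    have "cyl (map (g z) [0..<m]) = {z' \<in> V. \<forall>n<m. g z' n = g z n}" by (auto simp: cyl_def)
    moreover have "z \<in> cyl (map (g z) [0..<m])" using z(1) by (simp add: cyl_def)
    then have "\<not> null (cyl (map (g z) [0..<m]))" using z(2) unfolding M_def by blast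
    ultimately show ?thesis by simp
  qed
  then show ?thesis using z(3) by blast
qed

lemma finite_separating_length:
  fixes E :: "(nat \<Rightarrow> 'b) set"
  assumes "finite E"
  obtains m where "\<forall>a\<in>E. \<forall>b\<in>E. a \<noteq> b \<longrightarrow> (\<exists>n<m. a n \<noteq> b n)"
proof -
  define h where "h = (\<lambda>a b :: nat \<Rightarrow> 'b. SOME n. a n \<noteq> b n)"
  have h: "a (h a b) \<noteq> b (h a b)" if "a \<noteq> b" for a b :: "nat \<Rightarrow> 'b"
    using that unfolding h_def by (intro someI_ex[of "\<lambda>n. a n \<noteq> b n"]) auto
  have "finite ((\<lambda>(a, b). h a b) ` (E \<times> E))" using assms by simp
  then obtain m where "\<forall>n\<in>(\<lambda>(a, b). h a b) ` (E \<times> E). n < m"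
    unfolding finite_nat_set_iff_bounded by blast
  then have "h a b < m" if "a \<in> E" "b \<in> E" for a b using that by auto
  with h have "\<forall>a\<in>E. \<forall>b\<in>E. a \<noteq> b \<longrightarrow> (\<exists>n<m. a n \<noteq> b n)" by blast
  then show ?thesis by (rule that)
qed

text \<open>
  The values \<open>d s\<close> that the reservoirs may keep are finitely many and fibres of \<open>g\<close> are null,
  so positive sets \<open>S s\<close> remain whose values stay away from all of them.
\<close>

lemma chain_family_split:
  assumes \<Sigma>: "finite \<Sigma>" and A: "\<And>s. s \<in> \<Sigma> \<Longrightarrow> chain (J s) (A s)" and i: "\<And>s. s \<in> \<Sigma> \<Longrightarrow> i \<in> J s"
  shows "\<exists>A' S. \<forall>s\<in>\<Sigma>. chain (J s) (A' s) \<and> (\<forall>j. A' s j \<subseteq> A s j) \<and> S s \<subseteq> A s i \<and> \<not> null (S s) \<and>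
    (\<forall>s'\<in>\<Sigma>. sep (S s) (A' s' i) \<and> (s \<noteq> s' \<longrightarrow> sep (S s) (S s')))"
proof -
  have "\<forall>s\<in>\<Sigma>. \<exists>d. \<forall>m. \<exists>A'. chain (J s) A' \<and> (\<forall>j. A' j \<subseteq> A s j) \<and> (\<forall>z\<in>A' i. \<forall>n<m. g z n = d n)"
    using chain_localize[OF A i] by blast
  from bchoice[OF this] obtain d where d: "\<forall>s\<in>\<Sigma>. \<forall>m. \<exists>A'. chain (J s) A' \<and> (\<forall>j. A' j \<subseteq> A s j) \<and>
      (\<forall>z\<in>A' i. \<forall>n<m. g z n = d s n)"
    by (elim exE)
  \<comment> \<open>The new values are picked one at a time, each avoiding all values of
    \<open>d\<close> and the values picked before.\<close>
  have "\<exists>e. inj_on e \<Sigma>' \<and> e ` \<Sigma>' \<inter> d ` \<Sigma> = {} \<and>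
      (\<forall>s\<in>\<Sigma>'. \<forall>m. \<not> null {z \<in> A s i. \<forall>n<m. g z n = e s n})" if "finite \<Sigma>'" "\<Sigma>' \<subseteq> \<Sigma>" for \<Sigma>'
    using that
  proof (induction \<Sigma>' rule: finite_induct)
    case (insert s \<Sigma>')
    then obtain e where e: "inj_on e \<Sigma>'" "e ` \<Sigma>' \<inter> d ` \<Sigma> = {}"
      "\<forall>s\<in>\<Sigma>'. \<forall>m. \<not> null {z \<in> A s i. \<forall>n<m. g z n = e s n}"
      by simp (elim exE conjE, rule that)
    have "A s i \<subseteq> F" "\<not> null (A s i)" using A[of s] i[of s] insert.prems by (auto simp: chain_def)
    moreover have "finite (e ` \<Sigma>' \<union> d ` \<Sigma>)" using insert.hyps(1) \<Sigma> by simp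
    ultimately have "\<exists>c. c \<notin> e ` \<Sigma>' \<union> d ` \<Sigma> \<and> (\<forall>m. \<not> null {z \<in> A s i. \<forall>n<m. g z n = c n})"
      by (rule generic_value)
    then obtain c where c: "c \<notin> e ` \<Sigma>' \<union> d ` \<Sigma>" "\<forall>m. \<not> null {z \<in> A s i. \<forall>n<m. g z n = c n}"
      by (elim exE conjE)
    have [simp]: "(e(s := c)) ` \<Sigma>' = e ` \<Sigma>'" using insert.hyps by auto
    have "inj_on (e(s := c)) (insert s \<Sigma>')"
      using e(1) c(1) insert.hyps(2) by (auto simp: inj_on_def)
    moreover have "(e(s := c)) ` insert s \<Sigma>' \<inter> d ` \<Sigma> = {}"
      using e(2) c(1) by (simp only: image_insert) auto
    moreover have "\<forall>s'\<in>insert s \<Sigma>'. \<forall>m. \<not> null {z \<in> A s' i. \<forall>n<m. g z n = (e(s := c)) s' n}"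
      using e(3) c(2) insert.hyps by auto
    ultimately show ?case by (intro exI[of _ "e(s := c)"] conjI)
  qed auto
  from this[OF \<Sigma> order_refl] obtain e where e: "inj_on e \<Sigma>" "e ` \<Sigma> \<inter> d ` \<Sigma> = {}"
    "\<forall>s\<in>\<Sigma>. \<forall>m. \<not> null {z \<in> A s i. \<forall>n<m. g z n = e s n}" by (elim exE conjE)
  have "finite (e ` \<Sigma> \<union> d ` \<Sigma>)" using \<Sigma> by simp
  \<comment> \<open>One length at which all distinct values among the \<open>e s\<close> and
    \<open>d s\<close> differ. The \<open>d s\<close> themselves may coincide, so no separation
    among the sets \<open>A' s i\<close> results.\<close>
  then obtain m where m: "\<forall>a\<in>e ` \<Sigma> \<union> d ` \<Sigma>. \<forall>b\<in>e ` \<Sigma> \<union> d ` \<Sigma>. a \<noteq> b \<longrightarrow> (\<exists>n<m. a n \<noteq> b n)"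
    by (rule finite_separating_length)
  have "\<forall>s\<in>\<Sigma>. \<exists>A'. chain (J s) A' \<and> (\<forall>j. A' j \<subseteq> A s j) \<and> (\<forall>z\<in>A' i. \<forall>n<m. g z n = d s n)"
    using d by blast
  from bchoice[OF this] obtain A' where A': "\<forall>s\<in>\<Sigma>. chain (J s) (A' s) \<and> (\<forall>j. A' s j \<subseteq> A s j) \<and>
      (\<forall>z\<in>A' s i. \<forall>n<m. g z n = d s n)"
    by (elim exE)
  define S where "S = (\<lambda>s. {z \<in> A s i. \<forall>n<m. g z n = e s n})"
  have sep1: "sep (S s) (A' s' i)" if s: "s \<in> \<Sigma>" "s' \<in> \<Sigma>" for s s'
  proof -
    have "e s \<noteq> d s'" using e(2) s by blast
    then obtain n where n: "n < m" "e s n \<noteq> d s' n" using m s by blast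
    have "g z n \<noteq> g z' n" if "z \<in> S s" "z' \<in> A' s' i" for z z'
      using n A' s(2) that by (simp add: S_def)
    then show ?thesis using n(1) unfolding sep_def by blast
  qed
  have sep2: "sep (S s) (S s')" if s: "s \<in> \<Sigma>" "s' \<in> \<Sigma>" "s \<noteq> s'" for s s'
  proof -
    have "e s \<noteq> e s'" using inj_onD[OF e(1) _ s(1,2)] s(3) by blast
    then obtain n where n: "n < m" "e s n \<noteq> e s' n" using m s by blast
    have "g z n \<noteq> g z' n" if "z \<in> S s" "z' \<in> S s'" for z z'
      using n that by (simp add: S_def)
    then show ?thesis using n(1) unfolding sep_def by blast
  qed
  have "S s \<subseteq> A s i" for s by (auto simp: S_def)
  then show ?thesis using A' e(3) sep1 sep2 by (intro exI[of _ A'] exI[of _ S]) (simp add: S_def)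
qed

end

subsection \<open>The recursion\<close>

text \<open>
  At stage \<open>prod_encode (i, k)\<close> it is asked whether \<open>x i = k\<close>. Before its value has been hit by a
  question, a coordinate is treated as \<open>\<infinity>\<close>.
\<close>

definition settle :: "nat \<Rightarrow> (nat \<Rightarrow> enat) \<Rightarrow> nat \<Rightarrow> enat" where
  "settle t x i = (if \<exists>k. x i = enat k \<and> prod_encode (i, k) < t then x i else \<infinity>)"

definition nodes :: "nat \<Rightarrow> (nat \<Rightarrow> enat) set" where
  "nodes t = range (settle t)"

definition parent :: "nat \<Rightarrow> (nat \<Rightarrow> enat) \<Rightarrow> nat \<Rightarrow> enat" where
  "parent t r = (case prod_decode t of (i, k) \<Rightarrow> if r i = enat k then r(i := \<infinity>) else r)"

definition pending :: "nat \<Rightarrow> (nat \<Rightarrow> enat) \<Rightarrow> nat set" where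
  "pending t s = {j. j \<le> t \<and> s j = \<infinity>}"

lemma finite_pending [simp]: "finite (pending t s)"
  by (rule finite_subset[of _ "{..t}"]) (auto simp: pending_def)

lemma settle_0: "settle 0 x = (\<lambda>_. \<infinity>)"
  by (auto simp: settle_def)

lemma settle_Suc:
  assumes "prod_decode t = (i, k)"
  shows "settle (Suc t) x = (if x i = enat k then (settle t x)(i := enat k) else settle t x)"
proof -
  have t: "t = prod_encode (i, k)" using assms by (metis prod_decode_inverse)
  have "(\<exists>k'. x j = enat k' \<and> prod_encode (j, k') < Suc t) \<longleftrightarrow>
      (\<exists>k'. x j = enat k' \<and> prod_encode (j, k') < t) \<or> (j = i \<and> x j = enat k)" for j
    by (auto simp: less_Suc_eq t)
  then show ?thesis by (auto simp: settle_def fun_eq_iff)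
qed

lemma settle_decided:
  assumes "prod_decode t = (i, k)" shows "settle t x i \<noteq> enat k"
proof -
  have "t = prod_encode (i, k)" using assms by (metis prod_decode_inverse)
  then show ?thesis by (auto simp: settle_def)
qed

lemma settle_undecided:
  assumes "prod_decode t = (i, k)" "x i = enat k" shows "settle t x i = \<infinity>"
proof -
  have "t = prod_encode (i, k)" using assms(1) by (metis prod_decode_inverse)
  then show ?thesis using assms(2) by (simp add: settle_def)
qed

text \<open>At stage \<open>Suc t\<close>, the value \<open>k\<close> at coordinate \<open>i\<close>
  can only come from question \<open>t\<close> itself, so resetting it to \<open>\<infinity>\<close>
  undoes exactly that stage.\<close>

lemma parent_settle: "parent t (settle (Suc t) x) = settle t x"
proof -
  obtain i k where q: "prod_decode t = (i, k)" by fastforce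
  show ?thesis
    using settle_decided[OF q, of x] settle_undecided[OF q, of x]
    by (auto simp: parent_def q settle_Suc[OF q] fun_eq_iff)
qed

lemma parent_in_nodes: "r \<in> nodes (Suc t) \<Longrightarrow> parent t r \<in> nodes t"
  by (auto simp: nodes_def parent_settle)

lemma settle_in_nodes [simp]: "settle t x \<in> nodes t"
  by (simp add: nodes_def)

lemma finite_nodes: "finite (nodes t)"
proof (induction t)
  case 0
  have "nodes 0 \<subseteq> {\<lambda>_. \<infinity>}" by (auto simp: nodes_def settle_0)
  then show ?case by (rule finite_subset) simp
next
  case (Suc t)
  obtain i k where q: "prod_decode t = (i, k)" by fastforce
  have "nodes (Suc t) \<subseteq> nodes t \<union> (\<lambda>s. s(i := enat k)) ` nodes t"
    by (auto simp: nodes_def settle_Suc[OF q])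
  then show ?case by (rule finite_subset) (use Suc in simp)
qed

text \<open>Since \<open>j \<le> prod_encode (j, k)\<close>, no question about coordinate
  \<open>j\<close> precedes stage \<open>j\<close>.\<close>

lemma nodes_infinity:
  assumes "s \<in> nodes t" "t \<le> j" shows "s j = \<infinity>"
proof -
  obtain x where s: "s = settle t x" using assms(1) by (auto simp: nodes_def)
  have "\<not> prod_encode (j, k) < t" for k using le_prod_encode_1[of j k] assms(2) by linarith
  then show ?thesis by (simp add: s settle_def)
qed

lemma nodes_eqI:
  assumes "s \<in> nodes t" "s' \<in> nodes t" "\<And>l. l < t \<Longrightarrow> s l = s' l" shows "s = s'"
proof
  fix l show "s l = s' l"
    using assms nodes_infinity[of s t l] nodes_infinity[of s' t l] by (cases "l < t") auto
qed

text \<open>The reservoir of the parent that feeds the higher reservoirs of \<open>r\<close>: the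
  coordinate just found finite, or the last index \<open>t\<close> if question \<open>t\<close>
  leaves \<open>r\<close> without the value \<open>k\<close> there.\<close>

definition branch_index :: "nat \<Rightarrow> (nat \<Rightarrow> enat) \<Rightarrow> nat" where
  "branch_index t r = (case prod_decode t of (i, k) \<Rightarrow> if r i = enat k then i else t)"

lemma prod_decode_le: "prod_decode t = (i, k) \<Longrightarrow> i \<le> t"
  by (metis le_prod_encode_1 prod_decode_inverse)

lemma pending_parent:
  assumes r: "r \<in> nodes (Suc t)" and j: "j \<in> pending (Suc t) r"
  shows "min j (branch_index t r) \<in> pending t (parent t r)"
proof -
  obtain i k where q: "prod_decode t = (i, k)" by fastforce
  have i: "i \<le> t" by (rule prod_decode_le[OF q])
  show ?thesis
  proof (cases "r i = enat k")
    case True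
    then have "j \<noteq> i" using j by (auto simp: pending_def)
    then show ?thesis using True i j by (auto simp: branch_index_def q pending_def parent_def min_def)
  next
    case False
    have "parent t r = r" using False by (simp add: parent_def q)
    then have "r t = \<infinity>" using nodes_infinity[OF parent_in_nodes[OF r], of t] by simp
    then show ?thesis using False j by (auto simp: branch_index_def q pending_def parent_def min_def)
  qed
qed

context borel_unfolding
begin

text \<open>
  Sets in different classes \<open>(j, s \<restriction> j)\<close> are separated, but the \<open>j\<close>-th reservoirs of nodes that
  agree below \<open>j\<close> cannot be: their values may accumulate at a common point.
\<close>

definition scheme :: "(nat \<Rightarrow> enat) set \<Rightarrow> nat \<Rightarrow> ((nat \<Rightarrow> enat) \<Rightarrow> nat \<Rightarrow> 'z set) \<Rightarrow> bool" where
  "scheme N t R \<longleftrightarrow> (\<forall>s\<in>N. chain (pending t s) (R s) \<and> tight (pending t s) (R s)) \<and>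
     (\<forall>s\<in>N. \<forall>s'\<in>N. \<forall>j\<in>pending t s. \<forall>j'\<in>pending t s'.
        j \<noteq> j' \<or> (\<exists>l<j. s l \<noteq> s' l) \<longrightarrow> sep (R s j) (R s' j'))"

text \<open>Unlike in \<open>tight\<close>, the bound holds in the base space and for all indices at
  once. It thus covers coordinates whose value may still change, which is what makes the embedding
  continuous.\<close>

definition small_images :: "nat \<Rightarrow> ((nat \<Rightarrow> enat) \<Rightarrow> nat \<Rightarrow> 'z set) \<Rightarrow> bool" where
  "small_images t R \<longleftrightarrow> (\<forall>s\<in>nodes t. \<forall>j\<in>pending t s. \<forall>j'\<in>pending t s. \<forall>z\<in>R s j. \<forall>z'\<in>R s j'.
     dist (p z) (p z') \<le> (1/2) ^ t)"

lemma scheme_chain: "scheme N t R \<Longrightarrow> s \<in> N \<Longrightarrow> chain (pending t s) (R s)"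
  and scheme_tight: "scheme N t R \<Longrightarrow> s \<in> N \<Longrightarrow> tight (pending t s) (R s)"
  by (simp_all add: scheme_def)

lemma scheme_sep:
  assumes "scheme N t R" "s \<in> N" "s' \<in> N" "j \<in> pending t s" "j' \<in> pending t s'"
    "j \<noteq> j' \<or> (\<exists>l<j. s l \<noteq> s' l)"
  shows "sep (R s j) (R s' j')"
  using assms unfolding scheme_def by blast

lemma scheme_0:
  shows "\<exists>R. scheme (nodes 0) 0 R \<and> small_images 0 R"
proof -
  have "finite {0 :: nat}" by simp
  from fresh_chain[OF this order_refl not_null_F] obtain A where A: "chain {0} A" "tight {0} A"
    by (elim exE conjE)
  obtain W where W: "\<forall>x\<in>W. \<forall>y\<in>W. dist x y \<le> 1" "chain {0} (\<lambda>j. A j \<inter> p -` W)"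
    by (rule chain_small[OF A(1) zero_less_one])
  have n: "nodes 0 = {\<lambda>_. \<infinity>}" by (auto simp: nodes_def settle_0 image_def)
  have i: "pending 0 (\<lambda>_. \<infinity>) = {0}" by (auto simp: pending_def)
  have "tight {0} (\<lambda>j. A j \<inter> p -` W)" by (rule tight_mono[OF A(2)]) auto
  then have "scheme (nodes 0) 0 (\<lambda>_ j. A j \<inter> p -` W)" using W(2) by (simp add: scheme_def n i)
  moreover have "small_images 0 (\<lambda>_ j. A j \<inter> p -` W)" using W(1) by (simp add: small_images_def n i)
  ultimately show ?thesis by blast
qed

text \<open>The last reservoir of each node is replaced by two separated ones inside it, with
  indices \<open>t\<close> and \<open>Suc t\<close>.\<close>

lemma scheme_extend:
  assumes R: "scheme (nodes t) t R"
  shows "\<exists>R'. scheme (nodes t) (Suc t) R' \<and>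
    (\<forall>s\<in>nodes t. \<forall>j\<in>pending (Suc t) s. R' s j \<subseteq> R s (min j t))"
proof -
  have t: "t \<in> pending t s" if "s \<in> nodes t" for s
    using nodes_infinity[OF that order_refl] by (simp add: pending_def)
  have idx: "{j \<in> pending t s. j < t} \<union> {t, Suc t} = pending (Suc t) s" if "s \<in> nodes t" for s
    using nodes_infinity[OF that, of t] nodes_infinity[OF that, of "Suc t"]
    by (auto simp: pending_def le_Suc_eq)
  have "\<forall>s\<in>nodes t. \<exists>A. chain (pending (Suc t) s) A \<and> tight (pending (Suc t) s) A \<and>
      (\<forall>j<t. A j = R s j) \<and> A t \<subseteq> R s t \<and> A (Suc t) \<subseteq> R s t \<and> sep (A t) (A (Suc t)) \<and> sep (A (Suc t)) (A t)"
  proof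
    fix s assume s: "s \<in> nodes t"
    have "\<not> null (R s t)" using scheme_chain[OF R s] t[OF s] by (simp add: chain_def)
    moreover have "finite {t, Suc t}" "\<And>k. k \<in> {t, Suc t} \<Longrightarrow> t \<le> k" by auto
    ultimately have "\<exists>A. chain ({j \<in> pending t s. j < t} \<union> {t, Suc t}) A \<and>
        tight ({j \<in> pending t s. j < t} \<union> {t, Suc t}) A \<and> (\<forall>j<t. A j = R s j) \<and>
        (\<forall>j\<in>{t, Suc t}. A j \<subseteq> R s t) \<and> (\<forall>j\<in>{t, Suc t}. \<forall>j'\<in>{t, Suc t}. j \<noteq> j' \<longrightarrow> sep (A j) (A j'))"
      by (rule chain_tail[OF scheme_chain[OF R s] scheme_tight[OF R s] t[OF s] order_refl])
    then show "\<exists>A. chain (pending (Suc t) s) A \<and> tight (pending (Suc t) s) A \<and>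
      (\<forall>j<t. A j = R s j) \<and> A t \<subseteq> R s t \<and> A (Suc t) \<subseteq> R s t \<and> sep (A t) (A (Suc t)) \<and> sep (A (Suc t)) (A t)"
      unfolding idx[OF s] by simp
  qed
  from bchoice[OF this] obtain R' where R': "\<forall>s\<in>nodes t. chain (pending (Suc t) s) (R' s) \<and>
      tight (pending (Suc t) s) (R' s) \<and> (\<forall>j<t. R' s j = R s j) \<and> R' s t \<subseteq> R s t \<and> R' s (Suc t) \<subseteq> R s t \<and>
      sep (R' s t) (R' s (Suc t)) \<and> sep (R' s (Suc t)) (R' s t)"
    by (elim exE)
  have sub: "R' s j \<subseteq> R s (min j t)" if s: "s \<in> nodes t" and j: "j \<in> pending (Suc t) s" for s j
  proof -
    consider "j < t" | "j = t" | "j = Suc t" using j by (force simp: pending_def)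
    then show ?thesis
    proof cases
      case 1
      then have "R' s j = R s j" using R' s by blast
      then show ?thesis using 1 by simp
    qed (use R' s in auto)
  qed
  have mem: "min j t \<in> pending t s" if "s \<in> nodes t" "j \<in> pending (Suc t) s" for s j
    using that t[of s] by (auto simp: pending_def min_def)
  have "sep (R' s j) (R' s' j')"
    if *: "s \<in> nodes t" "s' \<in> nodes t" "j \<in> pending (Suc t) s" "j' \<in> pending (Suc t) s'"
      "j \<noteq> j' \<or> (\<exists>l<j. s l \<noteq> s' l)" for s s' j j'
  proof (cases "min j t \<noteq> min j' t \<or> (\<exists>l<min j t. s l \<noteq> s' l)")
    case True
    from scheme_sep[OF R *(1,2) mem[OF *(1,3)] mem[OF *(2,4)] True]
    show ?thesis using sub[OF *(1,3)] sub[OF *(2,4)] by (rule sep_mono)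
  next
    case False
    \<comment> \<open>Pairs not separated by \<open>R\<close> have both indices at least
      \<open>t\<close> and nodes agreeing below \<open>t\<close>, hence equal nodes; what remains is
      the new pair \<open>t\<close>, \<open>Suc t\<close>.\<close>
    have jt: "t \<le> j" "t \<le> j'"
    proof -
      have "\<not> j < t" using False *(5) by (auto simp: min_def split: if_splits)
      then show "t \<le> j" by simp
      then show "t \<le> j'" using False by (auto simp: min_def split: if_splits)
    qed
    then have "s = s'" using False nodes_eqI[OF *(1,2)] by (simp add: min_def)
    moreover have "{j, j'} = {t, Suc t}" using * jt \<open>s = s'\<close> by (auto simp: pending_def)
    ultimately show ?thesis using R' *(1) by (auto simp: doubleton_eq_iff)
  qed
  then have "scheme (nodes t) (Suc t) R'" using R' unfolding scheme_def by blast
  then show ?thesis using sub by blast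
qed

text \<open>Each node with \<open>\<infinity>\<close> at \<open>i\<close> is cut by
  \<open>chain_family_split\<close>. A child with value \<open>k\<close> keeps the reservoirs below
  \<open>i\<close>, loses index \<open>i\<close>, and gets a fresh chain inside \<open>S\<close>
  above it. The undecided node keeps the cut chain, and nodes with another finite value at
  \<open>i\<close> stay as they are.\<close>

lemma scheme_branch:
  assumes R: "scheme (nodes t) (Suc t) R" and q: "prod_decode t = (i, k)"
  shows "\<exists>R'. scheme (nodes (Suc t)) (Suc t) R' \<and>
    (\<forall>r\<in>nodes (Suc t). \<forall>j\<in>pending (Suc t) r. R' r j \<subseteq> R (parent t r) (if r i = enat k then min j i else j))"
proof -
  have i: "i \<le> t" by (rule prod_decode_le[OF q])
  define \<Sigma> where "\<Sigma> = {s \<in> nodes t. s i = \<infinity>}"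
  have \<Sigma>: "finite \<Sigma>" using finite_nodes by (simp add: \<Sigma>_def)
  have iJ: "i \<in> pending (Suc t) s" if "s \<in> \<Sigma>" for s using that i by (simp add: \<Sigma>_def pending_def)
  have Rc: "chain (pending (Suc t) s) (R s)" if "s \<in> \<Sigma>" for s
    using scheme_chain[OF R] that by (simp add: \<Sigma>_def)
  from chain_family_split[of \<Sigma> "pending (Suc t)" R i, OF \<Sigma> Rc iJ] obtain A S
    where AS: "\<forall>s\<in>\<Sigma>. chain (pending (Suc t) s) (A s) \<and> (\<forall>j. A s j \<subseteq> R s j) \<and> S s \<subseteq> R s i \<and>
      \<not> null (S s) \<and> (\<forall>s'\<in>\<Sigma>. sep (S s) (A s' i) \<and> (s \<noteq> s' \<longrightarrow> sep (S s) (S s')))"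
    by auto
  then have A: "\<And>s. s \<in> \<Sigma> \<Longrightarrow> chain (pending (Suc t) s) (A s)" "\<And>s j. s \<in> \<Sigma> \<Longrightarrow> A s j \<subseteq> R s j"
    and S: "\<And>s. s \<in> \<Sigma> \<Longrightarrow> S s \<subseteq> R s i" "\<And>s. s \<in> \<Sigma> \<Longrightarrow> \<not> null (S s)"
      "\<And>s s'. s \<in> \<Sigma> \<Longrightarrow> s' \<in> \<Sigma> \<Longrightarrow> sep (S s) (A s' i)"
      "\<And>s s'. s \<in> \<Sigma> \<Longrightarrow> s' \<in> \<Sigma> \<Longrightarrow> s \<noteq> s' \<Longrightarrow> sep (S s) (S s')"
    by simp_all
  define K where "K = (\<lambda>s. {j \<in> pending (Suc t) s. i < j})"
  have "\<forall>s\<in>\<Sigma>. \<exists>B. chain ({j \<in> pending (Suc t) s. j < i} \<union> K s) B \<and> tight ({j \<in> pending (Suc t) s. j < i} \<union> K s) B \<and>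
      (\<forall>j<i. B j = R s j) \<and> (\<forall>j\<in>K s. B j \<subseteq> S s) \<and> (\<forall>j\<in>K s. \<forall>j'\<in>K s. j \<noteq> j' \<longrightarrow> sep (B j) (B j'))"
  proof
    fix s assume s: "s \<in> \<Sigma>"
    then have "s \<in> nodes t" by (simp add: \<Sigma>_def)
    have "finite (K s)" by (simp add: K_def)
    moreover have "\<And>j. j \<in> K s \<Longrightarrow> i \<le> j" by (simp add: K_def)
    ultimately show "\<exists>B. chain ({j \<in> pending (Suc t) s. j < i} \<union> K s) B \<and> tight ({j \<in> pending (Suc t) s. j < i} \<union> K s) B \<and>
      (\<forall>j<i. B j = R s j) \<and> (\<forall>j\<in>K s. B j \<subseteq> S s) \<and> (\<forall>j\<in>K s. \<forall>j'\<in>K s. j \<noteq> j' \<longrightarrow> sep (B j) (B j'))"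
      by (rule chain_tail[OF Rc[OF s] scheme_tight[OF R \<open>s \<in> nodes t\<close>] iJ[OF s] S(1,2)[OF s]])
  qed
  from bchoice[OF this] obtain B where B: "\<forall>s\<in>\<Sigma>. chain ({j \<in> pending (Suc t) s. j < i} \<union> K s) (B s) \<and>
      tight ({j \<in> pending (Suc t) s. j < i} \<union> K s) (B s) \<and>
      (\<forall>j<i. B s j = R s j) \<and> (\<forall>j\<in>K s. B s j \<subseteq> S s) \<and> (\<forall>j\<in>K s. \<forall>j'\<in>K s. j \<noteq> j' \<longrightarrow> sep (B s j) (B s j'))"
    by (elim exE)
  define R' where "R' = (\<lambda>r. if r i = enat k then B (r(i := \<infinity>)) else if r i = \<infinity> then A r else R r)"
  have new: "parent t r = r(i := \<infinity>)" "parent t r \<in> \<Sigma>" "R' r = B (parent t r)"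
      "pending (Suc t) r = {j \<in> pending (Suc t) (parent t r). j < i} \<union> K (parent t r)"
    if "r \<in> nodes (Suc t)" "r i = enat k" for r
  proof -
    show *: "parent t r = r(i := \<infinity>)" using that(2) by (simp add: parent_def q)
    then show "parent t r \<in> \<Sigma>" using parent_in_nodes[OF that(1)] by (simp add: \<Sigma>_def)
    show "R' r = B (parent t r)" using * that(2) by (simp add: R'_def)
    show "pending (Suc t) r = {j \<in> pending (Suc t) (parent t r). j < i} \<union> K (parent t r)"
      unfolding * using that(2) by (auto simp: pending_def K_def neq_iff)
  qed
  have old: "parent t r = r" "r \<in> nodes t" if "r \<in> nodes (Suc t)" "r i \<noteq> enat k" for r
  proof -
    show "parent t r = r" using that(2) by (simp add: parent_def q)
    then show "r \<in> nodes t" using parent_in_nodes[OF that(1)] by simp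
  qed
  have ct: "chain (pending (Suc t) r) (R' r) \<and> tight (pending (Suc t) r) (R' r)" if r: "r \<in> nodes (Suc t)" for r
  proof (cases "r i = enat k")
    case True
    then show ?thesis using new[OF r True] B by simp
  next
    case False
    note o = old[OF r False]
    show ?thesis
    proof (cases "r i = \<infinity>")
      case True
      then have "r \<in> \<Sigma>" using o by (simp add: \<Sigma>_def)
      then show ?thesis using True A[of r] tight_mono[OF scheme_tight[OF R o(2)], of "A r"] by (simp add: R'_def)
    next
      case False
      then have "R' r = R r" using \<open>r i \<noteq> enat k\<close> by (auto simp: R'_def)
      then show ?thesis using scheme_chain[OF R o(2)] scheme_tight[OF R o(2)] by simp
    qed
  qed
  \<comment> \<open>The index of the parent's reservoir from which reservoir \<open>j\<close> of
    \<open>r\<close> is taken.\<close>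
  define org where "org = (\<lambda>r j. if r i = enat k then min j i else j)"
  have sub: "R' r j \<subseteq> R (parent t r) (org r j)" if r: "r \<in> nodes (Suc t)" and j: "j \<in> pending (Suc t) r" for r j
  proof (cases "r i = enat k")
    case True
    note n = new[OF r True]
    show ?thesis
    proof (cases "j < i")
      case True
      then have "R' r j = R (parent t r) j" using n(2,3) B by simp
      then show ?thesis using True \<open>r i = enat k\<close> by (simp add: org_def)
    next
      case False
      then have "j \<in> K (parent t r)" using j n(4) by auto
      then have "R' r j \<subseteq> S (parent t r)" using n(2,3) B by simp
      then show ?thesis using False \<open>r i = enat k\<close> S(1)[OF n(2)] by (simp add: org_def min_def) blast
    qed
  next
    case False
    note o = old[OF r False]
    have "r \<in> \<Sigma>" if "r i = \<infinity>" using that o(2) by (simp add: \<Sigma>_def)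
    then show ?thesis using False o(1) A(2)[of r j] by (auto simp: org_def R'_def)
  qed
  have orgJ: "org r j \<in> pending (Suc t) (parent t r)" if r: "r \<in> nodes (Suc t)" and j: "j \<in> pending (Suc t) r" for r j
  proof (cases "r i = enat k")
    case True
    note n = new[OF r True]
    show ?thesis using iJ[OF n(2)] j n(4) True by (auto simp: org_def min_def K_def)
  next
    case False
    then show ?thesis using old[OF r False] j by (simp add: org_def)
  qed
  have "sep (R' r j) (R' r' j')"
    if *: "r \<in> nodes (Suc t)" "r' \<in> nodes (Suc t)" "j \<in> pending (Suc t) r" "j' \<in> pending (Suc t) r'"
      "j \<noteq> j' \<or> (\<exists>l<j. r l \<noteq> r' l)" for r r' j j'
  proof (cases "org r j \<noteq> org r' j' \<or> (\<exists>l<org r j. parent t r l \<noteq> parent t r' l)")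
    case True
    from scheme_sep[OF R parent_in_nodes[OF *(1)] parent_in_nodes[OF *(2)] orgJ[OF *(1,3)] orgJ[OF *(2,4)] True]
    show ?thesis using sub[OF *(1,3)] sub[OF *(2,4)] by (rule sep_mono)
  next
    case False
    then have same: "org r j = org r' j'" "\<And>l. l < org r j \<Longrightarrow> parent t r l = parent t r' l" by auto
    \<comment> \<open>The origins are now in one class, so the old scheme does not separate them.
      Fresh reservoirs, those drawn from \<open>S\<close>, must be told apart by the properties of
      \<open>S\<close>, \<open>A\<close> and \<open>B\<close>.\<close>
    define fr where "fr = (\<lambda>r j. r i = enat k \<and> \<not> j < i)"
    have org_fresh: "org u l = i" "l \<in> K (parent t u)" "R' u l \<subseteq> S (parent t u)" "R' u = B (parent t u)" "parent t u \<in> \<Sigma>"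
      if u: "u \<in> nodes (Suc t)" "l \<in> pending (Suc t) u" "fr u l" for u l
    proof -
      have k: "u i = enat k" "\<not> l < i" using u(3) by (auto simp: fr_def)
      show "org u l = i" using k by (simp add: org_def min_def)
      show K: "l \<in> K (parent t u)" using k u(2) new(4)[OF u(1) k(1)] by auto
      show "R' u = B (parent t u)" "parent t u \<in> \<Sigma>" using new[OF u(1) k(1)] by auto
      then show "R' u l \<subseteq> S (parent t u)" using B K by simp
    qed
    have org_old: "org u l = l" if "\<not> fr u l" for u l
      using that by (auto simp: org_def fr_def)
    have mixed: "R' u i = A u i" "u \<in> \<Sigma>"
      if u: "u \<in> nodes (Suc t)" "i \<in> pending (Suc t) u" for u
    proof -
      have "u i = \<infinity>" using u(2) by (simp add: pending_def)
      then show "R' u i = A u i" "u \<in> \<Sigma>" using old[OF u(1)] by (auto simp: R'_def \<Sigma>_def)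
    qed
    show ?thesis
    proof (cases "fr r j")
      case 1: True
      note f = org_fresh[OF *(1,3) 1]
      show ?thesis
      proof (cases "fr r' j'")
        case True
        note f' = org_fresh[OF *(2,4) True]
        show ?thesis
        proof (cases "parent t r = parent t r'")
          case True
          then have "r = r'"
            using 1 \<open>fr r' j'\<close> new(1)[OF *(1)] new(1)[OF *(2)]
            by (metis fr_def fun_upd_triv fun_upd_upd)
          then have "j \<noteq> j'" using *(5) by auto
          then show ?thesis using B f f' True by (metis (no_types, lifting))
        next
          case False
          show ?thesis by (rule sep_mono[OF S(4)[OF f(5) f'(5) False] f(3) f'(3)])
        qed
      next
        case False
        \<comment> \<open>A fresh reservoir has origin \<open>i\<close>, so the old one is reservoir
          \<open>i\<close> of a node still undecided there, that is, its cut
          \<open>A\<close>.\<close>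
        then have "j' = i" using same(1) f(1) org_old by simp
        then show ?thesis using sep_mono[OF S(3)[OF f(5) mixed(2)] f(3) order_refl] mixed *(2,4) by metis
      qed
    next
      case 2: False
      show ?thesis
      proof (cases "fr r' j'")
        case True
        note f' = org_fresh[OF *(2,4) True]
        have "j = i" using 2 same(1) f'(1) org_old by simp
        then show ?thesis
          using sep_sym[OF sep_mono[OF S(3)[OF f'(5) mixed(2)] f'(3) order_refl]] mixed *(1,3) by metis
      next
        case False
        \<comment> \<open>For two old reservoirs, equal origins mean equal indices and nodes
          agreeing below them, against the assumption.\<close>
        then have jj: "j = j'" "org r j = j" using 2 same(1) org_old by auto
        have "r l = r' l" if "l < j" for l
        proof -
          have "parent t u l = u l" if u: "u \<in> nodes (Suc t)" "\<not> fr u j" for u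
          proof (cases "u i = enat k")
            case True
            then have "j < i" using u(2) by (simp add: fr_def)
            then show ?thesis using new(1)[OF u(1) True] \<open>l < j\<close> by simp
          next
            case False
            then show ?thesis using old[OF u(1)] by simp
          qed
          then show ?thesis using same(2)[of l] that jj 2 False *(1,2) by metis
        qed
        then show ?thesis using *(5) jj by blast
      qed
    qed
  qed
  then have "scheme (nodes (Suc t)) (Suc t) R'" using ct unfolding scheme_def by blast
  then show ?thesis using sub unfolding org_def by blast
qed

lemma scheme_shrink:
  assumes R: "scheme (nodes t) t R"
  shows "\<exists>R'. scheme (nodes t) t R' \<and> small_images t R' \<and> (\<forall>s j. R' s j \<subseteq> R s j)"
proof -
  have "\<exists>W. (\<forall>x\<in>W. \<forall>y\<in>W. dist x y \<le> (1/2) ^ t) \<and> chain (pending t s) (\<lambda>j. R s j \<inter> p -` W)"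
    if s: "s \<in> nodes t" for s
  proof -
    have "(0 :: real) < (1/2) ^ t" by simp
    then obtain W where "\<forall>x\<in>W. \<forall>y\<in>W. dist x y \<le> (1/2) ^ t" "chain (pending t s) (\<lambda>j. R s j \<inter> p -` W)"
      by (rule chain_small[OF scheme_chain[OF R s]])
    then show ?thesis by (intro exI[of _ W] conjI)
  qed
  then have "\<forall>s\<in>nodes t. \<exists>W. (\<forall>x\<in>W. \<forall>y\<in>W. dist x y \<le> (1/2) ^ t) \<and>
      chain (pending t s) (\<lambda>j. R s j \<inter> p -` W)"
    by (intro ballI)
  from bchoice[OF this] obtain W where W: "\<forall>s\<in>nodes t. (\<forall>x\<in>W s. \<forall>y\<in>W s. dist x y \<le> (1/2) ^ t) \<and>
      chain (pending t s) (\<lambda>j. R s j \<inter> p -` W s)"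
    by (elim exE)
  define R' where "R' = (\<lambda>s j. R s j \<inter> p -` W s)"
  have sub: "R' s j \<subseteq> R s j" for s j by (auto simp: R'_def)
  have "tight (pending t s) (R' s)" if "s \<in> nodes t" for s
    by (rule tight_mono[OF scheme_tight[OF R that] sub])
  moreover have "chain (pending t s) (R' s)" if "s \<in> nodes t" for s
    using W that by (simp add: R'_def)
  moreover have "sep (R' s j) (R' s' j')"
    if "s \<in> nodes t" "s' \<in> nodes t" "j \<in> pending t s" "j' \<in> pending t s'"
      "j \<noteq> j' \<or> (\<exists>l<j. s l \<noteq> s' l)" for s s' j j'
    by (rule sep_mono[OF scheme_sep[OF R that] sub sub])
  ultimately have "scheme (nodes t) t R'" unfolding scheme_def by blast
  moreover have "small_images t R'" using W by (auto simp: small_images_def R'_def)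
  ultimately show ?thesis using sub by blast
qed

lemma scheme_Suc:
  assumes "scheme (nodes t) t R"
  shows "\<exists>R'. (scheme (nodes (Suc t)) (Suc t) R' \<and> small_images (Suc t) R') \<and>
    (\<forall>r\<in>nodes (Suc t). \<forall>j\<in>pending (Suc t) r. R' r j \<subseteq> R (parent t r) (min j (branch_index t r)))"
proof -
  obtain i k where q: "prod_decode t = (i, k)" by fastforce
  have i: "i \<le> t" by (rule prod_decode_le[OF q])
  from scheme_extend[OF assms] obtain R1 where R1: "scheme (nodes t) (Suc t) R1"
    "\<forall>s\<in>nodes t. \<forall>j\<in>pending (Suc t) s. R1 s j \<subseteq> R s (min j t)" by (elim exE conjE)
  from scheme_branch[OF R1(1) q] obtain R2 where R2: "scheme (nodes (Suc t)) (Suc t) R2"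
    "\<forall>r\<in>nodes (Suc t). \<forall>j\<in>pending (Suc t) r. R2 r j \<subseteq> R1 (parent t r) (if r i = enat k then min j i else j)"
    by (elim exE conjE)
  from scheme_shrink[OF R2(1)] obtain R3 where R3: "scheme (nodes (Suc t)) (Suc t) R3" "small_images (Suc t) R3"
    "\<forall>s j. R3 s j \<subseteq> R2 s j" by (elim exE conjE)
  have "R3 r j \<subseteq> R (parent t r) (min j (branch_index t r))"
    if r: "r \<in> nodes (Suc t)" and j: "j \<in> pending (Suc t) r" for r j
  proof -
    define l where "l = (if r i = enat k then min j i else j)"
    have *: "min j (branch_index t r) = min l t" using i by (simp add: l_def branch_index_def q min_def)
    have "l \<in> pending (Suc t) (parent t r)"
      using pending_parent[OF r j] j i by (auto simp: l_def branch_index_def q pending_def parent_def)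
    then have "R1 (parent t r) l \<subseteq> R (parent t r) (min l t)" using R1(2) parent_in_nodes[OF r] by blast
    moreover have "R2 r j \<subseteq> R1 (parent t r) l" using R2(2) r j unfolding l_def by blast
    moreover have "R3 r j \<subseteq> R2 r j" using R3(3) by blast
    ultimately show ?thesis unfolding * by blast
  qed
  then show ?thesis using R3(1,2) by blast
qed

lemma scheme_exists:
  obtains R where "\<forall>t. scheme (nodes t) t (R t) \<and> small_images t (R t)"
    "\<forall>t. \<forall>r\<in>nodes (Suc t). \<forall>j\<in>pending (Suc t) r.
      R (Suc t) r j \<subseteq> R t (parent t r) (min j (branch_index t r))"
proof -
  have "\<exists>R. \<forall>t. (scheme (nodes t) t (R t) \<and> small_images t (R t)) \<and>
    (\<forall>r\<in>nodes (Suc t). \<forall>j\<in>pending (Suc t) r. R (Suc t) r j \<subseteq> R t (parent t r) (min j (branch_index t r)))"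
  proof (rule dependent_nat_choice)
    show "\<exists>R. scheme (nodes 0) 0 R \<and> small_images 0 R" by (rule scheme_0)
  next
    fix R t assume "scheme (nodes t) t R \<and> small_images t R"
    then show "\<exists>R'. (scheme (nodes (Suc t)) (Suc t) R' \<and> small_images (Suc t) R') \<and>
      (\<forall>r\<in>nodes (Suc t). \<forall>j\<in>pending (Suc t) r. R' r j \<subseteq> R (parent t r) (min j (branch_index t r)))"
      by (intro scheme_Suc) (elim conjE)
  qed
  then obtain R where "\<forall>t. (scheme (nodes t) t (R t) \<and> small_images t (R t)) \<and>
    (\<forall>r\<in>nodes (Suc t). \<forall>j\<in>pending (Suc t) r. R (Suc t) r j \<subseteq> R t (parent t r) (min j (branch_index t r)))"
    by (elim exE)
  then show ?thesis using that[of R] by simp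
qed

end

subsection \<open>The embedding\<close>

locale pawlikowski_scheme = borel_unfolding f F p g
  for f :: "'a::polish_space \<Rightarrow> nat \<Rightarrow> bool"
    and F :: "'z::{complete_space, second_countable_topology} set"
    and p :: "'z \<Rightarrow> 'a" and g :: "'z \<Rightarrow> nat \<Rightarrow> bool" +
  fixes R :: "nat \<Rightarrow> (nat \<Rightarrow> enat) \<Rightarrow> nat \<Rightarrow> 'z set"
  assumes R_scheme: "\<And>t. scheme (nodes t) t (R t)" and R_small: "\<And>t. small_images t (R t)"
    and R_nested: "\<And>t r j. r \<in> nodes (Suc t) \<Longrightarrow> j \<in> pending (Suc t) r \<Longrightarrow>
      R (Suc t) r j \<subseteq> R t (parent t r) (min j (branch_index t r))"
begin

definition settled :: "(nat \<Rightarrow> enat) \<Rightarrow> nat \<Rightarrow> nat \<Rightarrow> bool" where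
  "settled x n t \<longleftrightarrow> n \<le> t \<and> (\<forall>j<n. settle t x j = x j)"

text \<open>
  Only the coordinates from \<open>n\<close> on can still change once \<open>x\<close> is settled up to \<open>n\<close>, so from then on
  the approximations of the point coded by \<open>x\<close> stay in this set, whose diameter is at most \<open>(1/2) ^ n\<close>.
\<close>

definition tail_set :: "(nat \<Rightarrow> enat) \<Rightarrow> nat \<Rightarrow> nat \<Rightarrow> 'z set" where
  "tail_set x n t = (\<Union>j\<in>{j \<in> pending t (settle t x). n \<le> j}. R t (settle t x) j)"

lemma settle_settled: "settle t x j = x j \<Longrightarrow> t \<le> t' \<Longrightarrow> settle t' x j = x j"
  unfolding settle_def by (metis less_le_trans)

lemma settled_mono: "settled x n t \<Longrightarrow> t \<le> t' \<Longrightarrow> settled x n t'"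
  unfolding settled_def using settle_settled by (meson order_trans)

lemma settled_exists: "\<exists>t. settled x n t"
proof (induction n)
  case 0
  show ?case by (auto simp: settled_def)
next
  case (Suc n)
  then obtain t where t: "settled x n t" by blast
  have "\<exists>t'. settle t' x n = x n"
  proof (cases "x n")
    case (enat k)
    then have "settle (Suc (prod_encode (n, k))) x n = x n" by (auto simp: settle_def)
    then show ?thesis by blast
  qed (simp add: settle_def)
  then obtain t' where t': "settle t' x n = x n" by blast
  define T where "T = max (Suc n) (max t t')"
  have "settled x n T" by (rule settled_mono[OF t]) (simp add: T_def)
  moreover have "settle T x n = x n" by (rule settle_settled[OF t']) (simp add: T_def)
  ultimately have "settled x (Suc n) T" by (auto simp: settled_def T_def less_Suc_eq)
  then show ?case by blast
qed

text \<open>A question that changes the approximation concerns a coordinate not yet settled, hence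
  one from \<open>n\<close> on.\<close>

lemma branch_index_settle:
  assumes "settled x n t" shows "n \<le> branch_index t (settle (Suc t) x)"
proof -
  obtain i k where q: "prod_decode t = (i, k)" by fastforce
  show ?thesis
  proof (cases "settle (Suc t) x i = enat k")
    case True
    then have "x i = enat k" using settle_decided[OF q, of x] by (auto simp: settle_Suc[OF q] split: if_splits)
    then have "settle t x i \<noteq> x i" using settle_undecided[OF q, of x] by simp
    then have "n \<le> i" using assms unfolding settled_def by (meson not_le)
    then show ?thesis using True by (simp add: branch_index_def q)
  next
    case False
    then show ?thesis using assms by (simp add: branch_index_def q settled_def)
  qed
qed

lemma tail_set_Suc:
  assumes "settled x n t" shows "tail_set x n (Suc t) \<subseteq> tail_set x n t"
proof
  fix z assume "z \<in> tail_set x n (Suc t)"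
  then obtain j where j: "j \<in> pending (Suc t) (settle (Suc t) x)" "n \<le> j" "z \<in> R (Suc t) (settle (Suc t) x) j"
    by (auto simp: tail_set_def)
  define l where "l = min j (branch_index t (settle (Suc t) x))"
  have "l \<in> pending t (settle t x)"
    using pending_parent[OF settle_in_nodes j(1)] by (simp add: l_def parent_settle)
  moreover have "n \<le> l" using j(2) branch_index_settle[OF assms] by (simp add: l_def)
  moreover have "z \<in> R t (settle t x) l"
    using R_nested[OF settle_in_nodes j(1)] j(3) by (auto simp: l_def parent_settle)
  ultimately show "z \<in> tail_set x n t" unfolding tail_set_def by blast
qed

lemma tail_set_mono:
  assumes "settled x n t" "t \<le> t'" shows "tail_set x n t' \<subseteq> tail_set x n t"
  using assms(2)
proof (induction t' rule: dec_induct)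
  case (step t')
  then show ?case using tail_set_Suc[OF settled_mono[OF assms(1) step.hyps(1)]] by blast
qed simp

lemma R_subset_F: "j \<in> pending t (settle t x) \<Longrightarrow> R t (settle t x) j \<subseteq> F"
  using scheme_chain[OF R_scheme settle_in_nodes] unfolding chain_def by blast

lemma pending_last: "t \<in> pending t (settle t x)"
  using nodes_infinity[OF settle_in_nodes order_refl] by (simp add: pending_def)

lemma tail_set_dist:
  assumes "z \<in> tail_set x n t" "z' \<in> tail_set x n t" shows "dist z z' \<le> (1/2) ^ n"
proof -
  obtain j j' where j: "j \<in> pending t (settle t x)" "n \<le> j" "z \<in> R t (settle t x) j"
    and j': "j' \<in> pending t (settle t x)" "n \<le> j'" "z' \<in> R t (settle t x) j'"
    using assms unfolding tail_set_def by blast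
  have T: "tight (pending t (settle t x)) (R t (settle t x))" by (rule scheme_tight[OF R_scheme settle_in_nodes])
  have "dist z z' \<le> (1/2) ^ min j j'"
  proof (cases "j \<le> j'")
    case True
    then show ?thesis using T j j' unfolding tight_def by (simp add: min_def)
  next
    case False
    then have "dist z' z \<le> (1/2) ^ j'" using T j j' unfolding tight_def by (meson nat_le_linear)
    then show ?thesis using False by (simp add: min_def dist_commute)
  qed
  also have "(1/2 :: real) ^ min j j' \<le> (1/2) ^ n" using j(2) j'(2) by (intro power_decreasing) auto
  finally show ?thesis .
qed

section \<open>Convergence of the approximations\<close>

definition approx :: "(nat \<Rightarrow> enat) \<Rightarrow> nat \<Rightarrow> 'z" where
  "approx x t = (SOME z. z \<in> R t (settle t x) t)"

lemma approx_in: "approx x t \<in> R t (settle t x) t"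
proof -
  have "\<not> null (R t (settle t x) t)"
    using scheme_chain[OF R_scheme settle_in_nodes] pending_last unfolding chain_def by blast
  then have "R t (settle t x) t \<noteq> {}" by auto
  then show ?thesis unfolding approx_def by (simp add: some_in_eq)
qed

lemma approx_in_F: "approx x t \<in> F"
  using approx_in R_subset_F[OF pending_last] by blast

lemma approx_in_tail_set:
  assumes "settled x n t" "t \<le> t'" shows "approx x t' \<in> tail_set x n t"
proof -
  have "n \<le> t'" using settled_mono[OF assms] by (simp add: settled_def)
  then have "approx x t' \<in> tail_set x n t'"
    using approx_in pending_last unfolding tail_set_def by blast
  then show ?thesis using tail_set_mono[OF assms] by blast
qed

lemma Cauchy_approx: "Cauchy (approx x)"
proof (rule metric_CauchyI)
  fix \<epsilon> :: real assume "0 < \<epsilon>"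
  then obtain n where n: "(1/2) ^ n < \<epsilon>" using real_arch_pow_inv[of \<epsilon> "1/2"] by auto
  obtain t where t: "settled x n t" using settled_exists by blast
  have "dist (approx x a) (approx x b) < \<epsilon>" if "t \<le> a" "t \<le> b" for a b
    using tail_set_dist[OF approx_in_tail_set[OF t that(1)] approx_in_tail_set[OF t that(2)]] n by simp
  then show "\<exists>M. \<forall>m\<ge>M. \<forall>n\<ge>M. dist (approx x m) (approx x n) < \<epsilon>" by blast
qed

definition point :: "(nat \<Rightarrow> enat) \<Rightarrow> 'z" where
  "point x = lim (approx x)"

lemma approx_tendsto: "approx x \<longlonglongrightarrow> point x"
  using Cauchy_approx by (simp add: point_def Cauchy_convergent_iff convergent_LIMSEQ_iff)

lemma point_in_F: "point x \<in> F"
  by (rule closed_sequentially[OF closed_F approx_in_F approx_tendsto])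

lemma tendsto_comp_approx:
  assumes "continuous_on F h" shows "(\<lambda>t. h (approx x t)) \<longlonglongrightarrow> h (point x)"
  by (rule continuous_on_tendsto_compose[OF assms approx_tendsto point_in_F]) (simp add: approx_in_F)

definition emb :: "(nat \<Rightarrow> enat) \<Rightarrow> 'a" where
  "emb x = p (point x)"

lemma f_emb: "f (emb x) = g (point x)"
  using g_eq[OF point_in_F] by (simp add: emb_def)

section \<open>Continuity of the embedding\<close>

lemma open_settle_eq: "open {y. settle t y = settle t x}"
proof -
  \<comment> \<open>The sequences that answer question \<open>u\<close> as \<open>x\<close> does;
    this set is clopen because finite points of \<open>enat\<close> are isolated.\<close>
  define C where "C = (\<lambda>u. case prod_decode u of (i, k) \<Rightarrow>
      {y :: nat \<Rightarrow> enat. y i = enat k \<longleftrightarrow> x i = enat k})"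
  have "open (C u)" for u
  proof -
    obtain i k where q: "prod_decode u = (i, k)" by fastforce
    define S where "S = (if x i = enat k then {enat k} else - {enat k})"
    have "open S" using open_enat by (simp add: S_def open_Compl)
    from open_vimage[OF this continuous_on_product_coordinates[of i]]
    have "open ((\<lambda>y :: nat \<Rightarrow> enat. y i) -` S)" .
    moreover have "C u = (\<lambda>y. y i) -` S" by (auto simp: C_def q S_def)
    ultimately show ?thesis by simp
  qed
  then have "open (\<Inter>u\<in>{..<t}. C u)" by (intro open_INT) auto
  moreover have "{y. settle t y = settle t x} = (\<Inter>u\<in>{..<t}. C u)"
  proof (intro set_eqI iffI)
    fix y assume "y \<in> {y. settle t y = settle t x}"
    then have y: "settle t y i = settle t x i" for i by simp
    have "y \<in> C u" if "u < t" for u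
    proof -
      obtain i k where q: "prod_decode u = (i, k)" by fastforce
      then have "prod_encode (i, k) < t" using that by (metis prod_decode_inverse)
      then show ?thesis using y[of i] by (auto simp: C_def q settle_def split: if_splits)
    qed
    then show "y \<in> (\<Inter>u\<in>{..<t}. C u)" by blast
  next
    fix y assume y: "y \<in> (\<Inter>u\<in>{..<t}. C u)"
    have "y i = enat k \<longleftrightarrow> x i = enat k" if "prod_encode (i, k) < t" for i k
    proof -
      have "y \<in> C (prod_encode (i, k))" using y that by blast
      then show ?thesis by (simp add: C_def)
    qed
    then have "settle t y = settle t x" unfolding settle_def fun_eq_iff by metis
    then show "y \<in> {y. settle t y = settle t x}" by simp
  qed
  ultimately show ?thesis by simp
qed

lemma settled_0: "settled x 0 t"
  by (simp add: settled_def)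

lemma dist_emb:
  assumes "settle t y = settle t x" shows "dist (emb x) (emb y) \<le> (1/2) ^ t"
proof (rule LIMSEQ_le_const2)
  show "(\<lambda>u. dist (p (approx x u)) (p (approx y u))) \<longlonglongrightarrow> dist (emb x) (emb y)"
    unfolding emb_def by (intro tendsto_dist tendsto_comp_approx cont_p)
  have "dist (p (approx x u)) (p (approx y u)) \<le> (1/2) ^ t" if "t \<le> u" for u
  proof -
    \<comment> \<open>With bound 0 every stage counts as settled, so all later approximations stay
      in the reservoirs of the node at stage \<open>t\<close>.\<close>
    have "approx x u \<in> tail_set x 0 t" by (rule approx_in_tail_set[OF settled_0 that])
    then obtain j where j: "j \<in> pending t (settle t x)" "approx x u \<in> R t (settle t x) j"
      unfolding tail_set_def by blast
    have "approx y u \<in> tail_set y 0 t" by (rule approx_in_tail_set[OF settled_0 that])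
    then obtain j' where j': "j' \<in> pending t (settle t x)" "approx y u \<in> R t (settle t x) j'"
      unfolding tail_set_def assms by blast
    show ?thesis using R_small[of t] j j' settle_in_nodes[of t x] unfolding small_images_def by blast
  qed
  then show "\<exists>N. \<forall>u\<ge>N. dist (p (approx x u)) (p (approx y u)) \<le> (1/2) ^ t" by blast
qed

lemma continuous_emb: "continuous_on UNIV emb"
  unfolding continuous_on_topological
proof (intro ballI allI impI)
  fix x B assume "open B" "emb x \<in> B"
  then obtain \<epsilon> where \<epsilon>: "0 < \<epsilon>" "ball (emb x) \<epsilon> \<subseteq> B" by (meson openE)
  obtain t where t: "(1/2) ^ t < \<epsilon>" using real_arch_pow_inv[OF \<epsilon>(1), of "1/2"] by auto
  have "emb y \<in> B" if "settle t y = settle t x" for y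
  proof -
    have "emb y \<in> ball (emb x) \<epsilon>" using dist_emb[OF that] t by simp
    then show ?thesis using \<epsilon>(2) by blast
  qed
  then show "\<exists>A. open A \<and> x \<in> A \<and> (\<forall>y\<in>UNIV. y \<in> A \<longrightarrow> emb y \<in> B)"
    by (intro exI[of _ "{y. settle t y = settle t x}"]) (simp add: open_settle_eq)
qed

section \<open>Recovering coordinates from values\<close>

lemma R_persistent:
  assumes "settled x n t" "t \<le> t'" "n \<le> t" "settle t' x n = \<infinity>"
  shows "R t' (settle t' x) n \<subseteq> R t (settle t x) n"
  using assms(2,4)
proof (induction t' rule: dec_induct)
  case (step t')
  have s: "settled x n t'" by (rule settled_mono[OF assms(1) step.hyps(1)])
  have nb: "n \<le> branch_index t' (settle (Suc t') x)" by (rule branch_index_settle[OF s])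
  have pe: "n \<in> pending (Suc t') (settle (Suc t') x)" using step.prems assms(3) step.hyps by (simp add: pending_def)
  have "n \<in> pending t' (settle t' x)"
    using pending_parent[OF settle_in_nodes pe] nb by (simp add: parent_settle min_def)
  then have "R t' (settle t' x) n \<subseteq> R t (settle t x) n" using step.IH by (simp add: pending_def)
  moreover have "R (Suc t') (settle (Suc t') x) n \<subseteq> R t' (settle t' x) n"
    using R_nested[OF settle_in_nodes pe] nb by (simp add: parent_settle min_def)
  ultimately show ?case by blast
qed simp

text \<open>Here \<open>j\<close> is the first coordinate below \<open>t\<close> wrongly taken for
  \<open>\<infinity>\<close> at stage \<open>t\<close>, or \<open>t\<close> if there is none. When
  the mistake is discovered, all reservoirs from \<open>j\<close> on are drawn from reservoir
  \<open>j\<close>, which until then has only shrunk.\<close>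

lemma eventually_in_R:
  obtains j where "j \<in> pending t (settle t x)" "\<forall>l<j. settle t x l = x l" "j = t \<or> settle t x j \<noteq> x j"
    "\<forall>\<^sub>F u in sequentially. approx x u \<in> R t (settle t x) j"
proof (cases "settled x t t")
  case True
  have "approx x u \<in> R t (settle t x) t" if "t \<le> u" for u
    using approx_in_tail_set[OF True that] by (auto simp: tail_set_def pending_def)
  then have "\<forall>\<^sub>F u in sequentially. approx x u \<in> R t (settle t x) t" by (rule eventually_sequentiallyI)
  then show ?thesis using that[of t] pending_last True by (auto simp: settled_def)
next
  case False
  define j where "j = (LEAST j. settle t x j \<noteq> x j)"
  have ex: "\<exists>j<t. settle t x j \<noteq> x j" using False by (auto simp: settled_def)
  then have j: "settle t x j \<noteq> x j" unfolding j_def by (metis (mono_tags, lifting) LeastI)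
  have less: "settle t x l = x l" if "l < j" for l using not_less_Least that unfolding j_def by blast
  have jt: "j < t" using ex less by (metis not_less_iff_gr_or_eq order.strict_trans)
  obtain k where k: "x j = enat k" "settle t x j = \<infinity>" using j by (auto simp: settle_def split: if_splits) (cases "x j"; auto)
  \<comment> \<open>The stage at which the true value of coordinate \<open>j\<close> is asked
    for.\<close>
  define u where "u = prod_encode (j, k)"
  have q: "prod_decode u = (j, k)" by (simp add: u_def)
  have tu: "t \<le> u" using k by (auto simp: settle_def u_def split: if_splits)
  have s: "settled x j t" using jt less by (simp add: settled_def)
  have su: "settle (Suc u) x j = enat k" using k(1) by (simp add: settle_Suc[OF q])
  have "R (Suc u) (settle (Suc u) x) l \<subseteq> R t (settle t x) j"
    if l: "l \<in> pending (Suc u) (settle (Suc u) x)" "j \<le> l" for l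
  proof -
    have "R (Suc u) (settle (Suc u) x) l \<subseteq> R u (settle u x) j"
      using R_nested[OF settle_in_nodes l(1)] l(2) su by (simp add: parent_settle branch_index_def q min_absorb2)
    also have "\<dots> \<subseteq> R t (settle t x) j"
      using R_persistent[OF s tu] jt settle_undecided[where x = x, OF q k(1)] by simp
    finally show ?thesis .
  qed
  then have "tail_set x j (Suc u) \<subseteq> R t (settle t x) j" unfolding tail_set_def by blast
  moreover have "settled x j (Suc u)" by (rule settled_mono[OF s]) (use tu in simp)
  ultimately have "approx x v \<in> R t (settle t x) j" if "Suc u \<le> v" for v
    using approx_in_tail_set[OF _ that] by blast
  then have "\<forall>\<^sub>F v in sequentially. approx x v \<in> R t (settle t x) j" by (rule eventually_sequentiallyI)
  moreover have "j \<in> pending t (settle t x)" using jt k(2) by (simp add: pending_def)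
  ultimately show ?thesis using that[of j] less j by blast
qed

lemma eventually_bits: "\<forall>\<^sub>F u in sequentially. \<forall>n<m. g (approx x u) n = g (point x) n"
proof -
  have "\<forall>\<^sub>F u in sequentially. g (approx x u) n = g (point x) n" for n
  proof -
    have "continuous_on F (\<lambda>z. g z n)" by (rule continuous_on_product_then_coordinatewise[OF cont_g])
    from tendsto_comp_approx[OF this, of x] show ?thesis by (simp add: tendsto_discrete)
  qed
  then have "\<forall>\<^sub>F u in sequentially. \<forall>n\<in>{..<m}. g (approx x u) n = g (point x) n"
    by (intro eventually_ball_finite) auto
  then show ?thesis by (simp add: lessThan_iff Ball_def)
qed

text \<open>At a fixed stage there are finitely many pairs of a node and an index, so finitely many
  bits of \<open>f (emb x)\<close> exclude all pairs separated from that of \<open>x\<close>. A pair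
  that remains has the same index \<open>j\<close> and agrees below \<open>j\<close>, where both
  nodes already show the true coordinates.\<close>

lemma decode: "\<exists>m. \<forall>y. (\<forall>i<m. f (emb y) i = f (emb x) i) \<longrightarrow> (\<forall>l<n. y l = x l)"
proof -
  obtain t where t: "settled x n t" using settled_exists by blast
  obtain j where j: "j \<in> pending t (settle t x)" "\<forall>l<j. settle t x l = x l" "j = t \<or> settle t x j \<noteq> x j"
    "\<forall>\<^sub>F u in sequentially. approx x u \<in> R t (settle t x) j"
    by (rule eventually_in_R)
  have nj: "n \<le> j" using t j(3) by (auto simp: settled_def not_less)
  define far where "far = (\<lambda>s j'. j \<noteq> j' \<or> (\<exists>l<j. settle t x l \<noteq> s l))"
  define P where "P = {(s, j'). s \<in> nodes t \<and> j' \<in> pending t s \<and> far s j'}"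
  have "P \<subseteq> nodes t \<times> {..t}" by (auto simp: P_def pending_def)
  then have finP: "finite P" by (rule finite_subset) (simp add: finite_nodes)
  have "\<forall>q\<in>P. \<exists>m. \<forall>z\<in>R t (settle t x) j. \<forall>z'\<in>R t (fst q) (snd q). \<exists>n<m. g z n \<noteq> g z' n"
  proof
    fix q assume "q \<in> P"
    then have q: "fst q \<in> nodes t" "snd q \<in> pending t (fst q)" "far (fst q) (snd q)"
      by (auto simp: P_def)
    have "sep (R t (settle t x) j) (R t (fst q) (snd q))"
      by (rule scheme_sep[OF R_scheme settle_in_nodes q(1) j(1) q(2)]) (use q(3) in \<open>simp add: far_def\<close>)
    then show "\<exists>m. \<forall>z\<in>R t (settle t x) j. \<forall>z'\<in>R t (fst q) (snd q). \<exists>n<m. g z n \<noteq> g z' n"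
      by (simp add: sep_def)
  qed
  from bchoice[OF this] obtain M where M: "\<forall>q\<in>P. \<forall>z\<in>R t (settle t x) j. \<forall>z'\<in>R t (fst q) (snd q).
      \<exists>n<M q. g z n \<noteq> g z' n" by (elim exE)
  define m where "m = Max (insert 0 (M ` P))"
  have Mm: "M q \<le> m" if "q \<in> P" for q using finP that by (simp add: m_def)
  have "\<forall>l<n. y l = x l" if y: "\<forall>i<m. f (emb y) i = f (emb x) i" for y
  proof -
    obtain j' where j': "j' \<in> pending t (settle t y)" "\<forall>l<j'. settle t y l = y l" "j' = t \<or> settle t y j' \<noteq> y j'"
      "\<forall>\<^sub>F u in sequentially. approx y u \<in> R t (settle t y) j'"
      by (rule eventually_in_R)
    have "\<not> far (settle t y) j'"
    proof
      assume "far (settle t y) j'"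
      then have P: "(settle t y, j') \<in> P" using j'(1) by (simp add: P_def)
      \<comment> \<open>The limits need not lie in the reservoirs, but late approximations do, and
        their first \<open>m\<close> bits already equal those of the limits.\<close>
      have "\<forall>\<^sub>F u in sequentially. approx x u \<in> R t (settle t x) j \<and> approx y u \<in> R t (settle t y) j' \<and>
          (\<forall>n<m. g (approx x u) n = g (point x) n) \<and> (\<forall>n<m. g (approx y u) n = g (point y) n)"
        using j(4) j'(4) eventually_bits[of m x] eventually_bits[of m y] by eventually_elim blast
      from eventually_happens[OF this] obtain u where u: "approx x u \<in> R t (settle t x) j" "approx y u \<in> R t (settle t y) j'"
          "\<forall>n<m. g (approx x u) n = g (point x) n" "\<forall>n<m. g (approx y u) n = g (point y) n"
        by auto
      obtain i where "i < M (settle t y, j')" "g (approx x u) i \<noteq> g (approx y u) i"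
        using M P u(1,2) by fastforce
      moreover have "i < m" using Mm[OF P] calculation(1) by simp
      ultimately show False using u(3,4) y by (simp add: f_emb)
    qed
    then have "j' = j" "\<And>l. l < j \<Longrightarrow> settle t x l = settle t y l" by (auto simp: far_def)
    then show ?thesis using j(2) j'(2) nj by (metis order_less_le_trans)
  qed
  then show ?thesis by blast
qed

lemma contains_pawlikowski: "contains_pawlikowski f"
proof -
  define \<psi> where "\<psi> = (\<lambda>u. f (emb (pawlikowski_inv u)))"
  have dec: "\<exists>m. \<forall>v. (\<forall>i<m. \<psi> v i = \<psi> u i) \<longrightarrow> (\<forall>l<n. v l = u l)" for u n
  proof -
    obtain m where m: "\<forall>y. (\<forall>i<m. f (emb y) i = f (emb (pawlikowski_inv u)) i) \<longrightarrow>
        (\<forall>l<n. y l = pawlikowski_inv u l)" using decode by blast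
    have "\<forall>l<n. v l = u l" if "\<forall>i<m. \<psi> v i = \<psi> u i" for v
    proof (intro allI impI)
      fix l assume "l < n"
      then have "pawlikowski_inv v l = pawlikowski_inv u l" using m that by (simp add: \<psi>_def)
      then have "pawlikowski (pawlikowski_inv v) l = pawlikowski (pawlikowski_inv u) l"
        by (simp only: pawlikowski_def)
      then show "v l = u l" by simp
    qed
    then show ?thesis by blast
  qed
  have inj: "inj \<psi>"
  proof (rule injI, rule ext)
    fix u v l assume "\<psi> u = \<psi> v"
    then show "u l = v l" using dec[of v "Suc l"] by auto
  qed
  have "open_map euclidean (top_of_set (range \<psi>)) \<psi>"
    unfolding open_map_def
  proof (intro allI impI)
    fix U :: "(nat \<Rightarrow> nat) set" assume "openin euclidean U"
    then have U: "open U" by simp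
    show "openin (top_of_set (range \<psi>)) (\<psi> ` U)"
      unfolding openin_subopen[of _ "\<psi> ` U"]
    proof
      fix e assume "e \<in> \<psi> ` U"
      then obtain u where u: "u \<in> U" "e = \<psi> u" by blast
      obtain n where n: "\<forall>v. (\<forall>i<n. v i = u i) \<longrightarrow> v \<in> U" by (rule open_contains_cylinder[OF U u(1)])
      obtain m where m: "\<forall>v. (\<forall>i<m. \<psi> v i = \<psi> u i) \<longrightarrow> (\<forall>l<n. v l = u l)" using dec by blast
      \<comment> \<open>The first \<open>m\<close> bits of a value determine the first
        \<open>n\<close> coordinates of its code, so this trace of a cylinder lies in the image of
        \<open>U\<close>.\<close>
      have "openin (top_of_set (range \<psi>)) (range \<psi> \<inter> {e'. \<forall>i<m. e' i = e i})"
        by (rule openin_open_Int[OF open_cylinder])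
      moreover have "e \<in> range \<psi> \<inter> {e'. \<forall>i<m. e' i = e i}" using u(2) by simp
      moreover have "range \<psi> \<inter> {e'. \<forall>i<m. e' i = e i} \<subseteq> \<psi> ` U" using m n u(2) by auto
      ultimately show "\<exists>T. openin (top_of_set (range \<psi>)) T \<and> e \<in> T \<and> T \<subseteq> \<psi> ` U" by blast
    qed
  qed
  then have "open_injection \<psi>" using inj by (simp add: open_injection_def)
  moreover have "inj emb"
  proof (rule injI, rule ext)
    fix x y l assume "emb x = emb y"
    then show "x l = y l" using decode[of y "Suc l"] by auto
  qed
  moreover have "\<psi> \<circ> pawlikowski = f \<circ> emb" by (simp add: fun_eq_iff \<psi>_def)
  ultimately show ?thesis using continuous_emb unfolding contains_pawlikowski_def by blast
qed

end

theorem theorem4: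
  fixes f :: "'a::polish_space \<Rightarrow> (nat \<Rightarrow> bool)"
  assumes "f \<in> borel_measurable borel"
  shows "(sigma_continuous f \<or> contains_pawlikowski f) \<and>
         \<not> (sigma_continuous f \<and> contains_pawlikowski f)"
proof -
  have "contains_pawlikowski f" if ns: "\<not> sigma_continuous f"
  proof -
    obtain F :: "('a \<times> (nat \<Rightarrow> real)) set" and g where
      F: "closed F" "continuous_on F g" "\<forall>z\<in>F. g z = f (fst z)" "fst ` F = UNIV"
      using borel_function_unfolding[OF assms] .
    interpret borel_unfolding f F fst g
      by unfold_locales (use F ns in \<open>auto intro!: continuous_intros\<close>)
    obtain R where R: "\<forall>t. scheme (nodes t) t (R t) \<and> small_images t (R t)"
      "\<forall>t. \<forall>r\<in>nodes (Suc t). \<forall>j\<in>pending (Suc t) r.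
        R (Suc t) r j \<subseteq> R t (parent t r) (min j (branch_index t r))"
      using scheme_exists .
    interpret pawlikowski_scheme f F fst g R
      by unfold_locales (use R in simp_all)
    show ?thesis by (rule contains_pawlikowski)
  qed
  then show ?thesis using contains_pawlikowski_imp_not_sigma_continuous by blast
qed

end
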